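(* Let $H$ be a unital associative algebra over a field $F$. The functor $K\colon{}_H\mathcal M\to{}_H\mathbf{NAAlgSubMod}$ is left adjoint to the forgetful functor $U\colon{}_H\mathbf{NAAlgSubMod}\to{}_H\mathcal M$.
   Context: ${}_H\mathcal M$ is the category of left $H$-modules. ${}_H\mathbf{NAAlgSubMod}$ is the category whose objects are not necessarily associative $F$-algebras $A$ with a distinguished subspace $A_0\subseteq A$ (the inclusion may be proper) which is a left $H$-module, and whose morphisms from $A\supseteq A_0$ to $B\supseteq B_0$ are the algebra homomorphisms $\varphi\colon A\to B$ such that $\varphi(A_0)\subseteq B_0$ and $\varphi|_{A_0}$ is a homomorphism of $H$-modules. $U$ is given by $UA:=A_0$ and $U\varphi:=\varphi|_{A_0}$. For a left $H$-module $V$, $KV$ is the absolutely free non-associative $F$-algebra on an $F$-basis of $V$; equivalently $KV=\bigoplus_{n=1}^\infty\bigoplus_{\text{arrangements of brackets}}V^{\otimes n}$ (tensor products over $F$) with multiplication $vw=v\otimes w$ (with the corresponding bracket arrangement). $V$ is identified with the degree $1$ part of $KV$, and $KV\supseteq V$ is regarded as an object of ${}_H\mathbf{NAAlgSubMod}$. For a morphism $\varphi\colon V\to W$ in ${}_H\mathcal M$, $K\varphi\colon KV\to KW$ is the unique algebra homomorphism with $(K\varphi)|_V=\varphi$. *)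

theory Defs
  imports "HOL-Algebra.Module" "HOL-Library.FSet"
begin

section \<open>Categories, functors, adjunctions\<close>

text \<open>
  \<open>Comp C X Y Z g f\<close> is the composite of \<open>f : X \<rightarrow> Y\<close> with \<open>g : Y \<rightarrow> Z\<close>.  An arrow does not
  carry its domain and codomain, so composition and the arrow part of a functor take the objects
  as arguments.
\<close>

record ('o, 'm) category =
  Ob :: "'o set"
  Hom :: "'o \<Rightarrow> 'o \<Rightarrow> 'm set"
  Ident :: "'o \<Rightarrow> 'm"
  Comp :: "'o \<Rightarrow> 'o \<Rightarrow> 'o \<Rightarrow> 'm \<Rightarrow> 'm \<Rightarrow> 'm"

locale is_category =
  fixes C :: "('o, 'm) category"
  assumes ident_in_hom: "X \<in> Ob C \<Longrightarrow> Ident C X \<in> Hom C X X"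
    and comp_in_hom:
      "\<lbrakk>X \<in> Ob C; Y \<in> Ob C; Z \<in> Ob C; f \<in> Hom C X Y; g \<in> Hom C Y Z\<rbrakk>
        \<Longrightarrow> Comp C X Y Z g f \<in> Hom C X Z"
    and comp_ident_right:
      "\<lbrakk>X \<in> Ob C; Y \<in> Ob C; f \<in> Hom C X Y\<rbrakk> \<Longrightarrow> Comp C X X Y f (Ident C X) = f"
    and comp_ident_left:
      "\<lbrakk>X \<in> Ob C; Y \<in> Ob C; f \<in> Hom C X Y\<rbrakk> \<Longrightarrow> Comp C X Y Y (Ident C Y) f = f"
    and comp_assoc:
      "\<lbrakk>W \<in> Ob C; X \<in> Ob C; Y \<in> Ob C; Z \<in> Ob C;
        f \<in> Hom C W X; g \<in> Hom C X Y; h \<in> Hom C Y Z\<rbrakk>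
        \<Longrightarrow> Comp C W X Z (Comp C X Y Z h g) f = Comp C W Y Z h (Comp C W X Y g f)"

locale is_functor = source: is_category C + target: is_category D
  for C :: "('o, 'm) category" and D :: "('p, 'n) category" +
  fixes Fob :: "'o \<Rightarrow> 'p" and Farr :: "'o \<Rightarrow> 'o \<Rightarrow> 'm \<Rightarrow> 'n"
  assumes functor_ob: "X \<in> Ob C \<Longrightarrow> Fob X \<in> Ob D"
    and functor_arr:
      "\<lbrakk>X \<in> Ob C; Y \<in> Ob C; f \<in> Hom C X Y\<rbrakk> \<Longrightarrow> Farr X Y f \<in> Hom D (Fob X) (Fob Y)"
    and functor_ident: "X \<in> Ob C \<Longrightarrow> Farr X X (Ident C X) = Ident D (Fob X)"
    and functor_comp:
      "\<lbrakk>X \<in> Ob C; Y \<in> Ob C; Z \<in> Ob C; f \<in> Hom C X Y; g \<in> Hom C Y Z\<rbrakk>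
        \<Longrightarrow> Farr X Z (Comp C X Y Z g f)
            = Comp D (Fob X) (Fob Y) (Fob Z) (Farr Y Z g) (Farr X Y f)"

text \<open>\<open>(Lob, Larr) : C \<rightarrow> D\<close> is left adjoint to \<open>(Rob, Rarr) : D \<rightarrow> C\<close>: there are bijections
  \<open>\<Phi> X Y : Hom D (L X) Y \<rightarrow> Hom C X (R Y)\<close>, natural in \<open>X\<close> and \<open>Y\<close>.\<close>

definition left_adjoint ::
  "('o, 'm) category \<Rightarrow> ('p, 'n) category \<Rightarrow>
   ('o \<Rightarrow> 'p) \<Rightarrow> ('o \<Rightarrow> 'o \<Rightarrow> 'm \<Rightarrow> 'n) \<Rightarrow>
   ('p \<Rightarrow> 'o) \<Rightarrow> ('p \<Rightarrow> 'p \<Rightarrow> 'n \<Rightarrow> 'm) \<Rightarrow> bool"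
  where "left_adjoint C D Lob Larr Rob Rarr \<longleftrightarrow>
    is_functor C D Lob Larr \<and> is_functor D C Rob Rarr \<and>
    (\<exists>\<Phi>.
      (\<forall>X\<in>Ob C. \<forall>Y\<in>Ob D. bij_betw (\<Phi> X Y) (Hom D (Lob X) Y) (Hom C X (Rob Y))) \<and>
      (\<forall>X\<in>Ob C. \<forall>X'\<in>Ob C. \<forall>Y\<in>Ob D. \<forall>Y'\<in>Ob D.
        \<forall>f\<in>Hom C X' X. \<forall>g\<in>Hom D Y Y'. \<forall>h\<in>Hom D (Lob X) Y.
          \<Phi> X' Y' (Comp D (Lob X') Y Y' g (Comp D (Lob X') (Lob X) Y h (Larr X' X f)))
          = Comp C X' (Rob Y) (Rob Y') (Rarr Y Y' g) (Comp C X' X (Rob Y) (\<Phi> X Y h) f)))"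


section \<open>Algebras and modules\<close>

text \<open>The library's \<open>algebra\<close> is commutative and its \<open>module\<close> is over a commutative ring, so
  neither covers \<open>H\<close> and its modules.\<close>

locale unital_assoc_algebra = module F H + ring H
  for F (structure) and H (structure) +
  assumes smult_mult_left:
      "\<lbrakk>a \<in> carrier F; x \<in> carrier H; y \<in> carrier H\<rbrakk>
        \<Longrightarrow> (a \<odot>\<^bsub>H\<^esub> x) \<otimes>\<^bsub>H\<^esub> y = a \<odot>\<^bsub>H\<^esub> (x \<otimes>\<^bsub>H\<^esub> y)"
    and smult_mult_right:
      "\<lbrakk>a \<in> carrier F; x \<in> carrier H; y \<in> carrier H\<rbrakk>
        \<Longrightarrow> x \<otimes>\<^bsub>H\<^esub> (a \<odot>\<^bsub>H\<^esub> y) = a \<odot>\<^bsub>H\<^esub> (x \<otimes>\<^bsub>H\<^esub> y)"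

text \<open>As in the library's \<open>module\<close>, the fields \<open>mult\<close> and \<open>one\<close> of the record \<open>V\<close> are unused.\<close>

locale left_module = ring H + V?: abelian_group V
  for H (structure) and V (structure) +
  assumes smult_closed:
      "\<lbrakk>h \<in> carrier H; v \<in> carrier V\<rbrakk> \<Longrightarrow> h \<odot>\<^bsub>V\<^esub> v \<in> carrier V"
    and smult_l_distr:
      "\<lbrakk>h \<in> carrier H; k \<in> carrier H; v \<in> carrier V\<rbrakk>
        \<Longrightarrow> (h \<oplus>\<^bsub>H\<^esub> k) \<odot>\<^bsub>V\<^esub> v = h \<odot>\<^bsub>V\<^esub> v \<oplus>\<^bsub>V\<^esub> k \<odot>\<^bsub>V\<^esub> v"
    and smult_r_distr:
      "\<lbrakk>h \<in> carrier H; v \<in> carrier V; w \<in> carrier V\<rbrakk>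
        \<Longrightarrow> h \<odot>\<^bsub>V\<^esub> (v \<oplus>\<^bsub>V\<^esub> w) = h \<odot>\<^bsub>V\<^esub> v \<oplus>\<^bsub>V\<^esub> h \<odot>\<^bsub>V\<^esub> w"
    and smult_assoc:
      "\<lbrakk>h \<in> carrier H; k \<in> carrier H; v \<in> carrier V\<rbrakk>
        \<Longrightarrow> (h \<otimes>\<^bsub>H\<^esub> k) \<odot>\<^bsub>V\<^esub> v = h \<odot>\<^bsub>V\<^esub> (k \<odot>\<^bsub>V\<^esub> v)"
    and smult_one: "v \<in> carrier V \<Longrightarrow> \<one>\<^bsub>H\<^esub> \<odot>\<^bsub>V\<^esub> v = v"

text \<open>The \<open>F\<close>-space underlying a left \<open>H\<close>-module: \<open>c\<close> acts as \<open>c 1\<^sub>H\<close>.\<close>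

definition restrict_scalars ::
  "('f, 'h, 'k) module_scheme \<Rightarrow> ('h, 'v) module \<Rightarrow> ('f, 'v) module"
  where "restrict_scalars H V =
    \<lparr>carrier = carrier V, mult = mult V, one = one V, zero = zero V, add = add V,
     smult = (\<lambda>c v. (c \<odot>\<^bsub>H\<^esub> \<one>\<^bsub>H\<^esub>) \<odot>\<^bsub>V\<^esub> v)\<rparr>"

text \<open>Not necessarily associative, not necessarily unital: the field \<open>one\<close> of the record is
  unused.\<close>

locale nonassoc_algebra = module F A
  for F (structure) and A (structure) +
  assumes mult_closed:
      "\<lbrakk>x \<in> carrier A; y \<in> carrier A\<rbrakk> \<Longrightarrow> x \<otimes>\<^bsub>A\<^esub> y \<in> carrier A"
    and mult_l_distr:
      "\<lbrakk>x \<in> carrier A; y \<in> carrier A; z \<in> carrier A\<rbrakk>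
        \<Longrightarrow> (x \<oplus>\<^bsub>A\<^esub> y) \<otimes>\<^bsub>A\<^esub> z = x \<otimes>\<^bsub>A\<^esub> z \<oplus>\<^bsub>A\<^esub> y \<otimes>\<^bsub>A\<^esub> z"
    and mult_r_distr:
      "\<lbrakk>x \<in> carrier A; y \<in> carrier A; z \<in> carrier A\<rbrakk>
        \<Longrightarrow> x \<otimes>\<^bsub>A\<^esub> (y \<oplus>\<^bsub>A\<^esub> z) = x \<otimes>\<^bsub>A\<^esub> y \<oplus>\<^bsub>A\<^esub> x \<otimes>\<^bsub>A\<^esub> z"
    and smult_mult_left:
      "\<lbrakk>a \<in> carrier F; x \<in> carrier A; y \<in> carrier A\<rbrakk>
        \<Longrightarrow> (a \<odot>\<^bsub>A\<^esub> x) \<otimes>\<^bsub>A\<^esub> y = a \<odot>\<^bsub>A\<^esub> (x \<otimes>\<^bsub>A\<^esub> y)"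
    and smult_mult_right:
      "\<lbrakk>a \<in> carrier F; x \<in> carrier A; y \<in> carrier A\<rbrakk>
        \<Longrightarrow> x \<otimes>\<^bsub>A\<^esub> (a \<odot>\<^bsub>A\<^esub> y) = a \<odot>\<^bsub>A\<^esub> (x \<otimes>\<^bsub>A\<^esub> y)"

text \<open>Homomorphisms are extensional functions (\<open>undefined\<close> off the carrier), so that equality of
  morphisms is equality on the carrier.\<close>

definition linear_maps ::
  "('r, 's) ring_scheme \<Rightarrow> ('r, 'v, 'k) module_scheme \<Rightarrow> ('r, 'w, 'l) module_scheme
    \<Rightarrow> ('v \<Rightarrow> 'w) set"
  where "linear_maps R V W = {f \<in> carrier V \<rightarrow>\<^sub>E carrier W.
    (\<forall>x\<in>carrier V. \<forall>y\<in>carrier V. f (x \<oplus>\<^bsub>V\<^esub> y) = f x \<oplus>\<^bsub>W\<^esub> f y) \<and>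
    (\<forall>r\<in>carrier R. \<forall>x\<in>carrier V. f (r \<odot>\<^bsub>V\<^esub> x) = r \<odot>\<^bsub>W\<^esub> f x)}"

definition algebra_homs ::
  "('f, 's) ring_scheme \<Rightarrow> ('f, 'a, 'k) module_scheme \<Rightarrow> ('f, 'b, 'l) module_scheme
    \<Rightarrow> ('a \<Rightarrow> 'b) set"
  where "algebra_homs F A B = {f \<in> linear_maps F A B.
    \<forall>x\<in>carrier A. \<forall>y\<in>carrier A. f (x \<otimes>\<^bsub>A\<^esub> y) = f x \<otimes>\<^bsub>B\<^esub> f y}"


section \<open>The two categories and the functor \<open>U\<close>\<close>

definition HMod :: "('h, 'n) ring_scheme \<Rightarrow> (('h, 'v) module, 'v \<Rightarrow> 'v) category"
  where "HMod H =
    \<lparr>Ob = {V. left_module H V},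
     Hom = linear_maps H,
     Ident = (\<lambda>V. restrict id (carrier V)),
     Comp = (\<lambda>U V W g f. compose (carrier U) g f)\<rparr>"

text \<open>\<open>dsub A\<close> is the distinguished subspace \<open>A\<^sub>0\<close>, and \<open>hact A\<close> the action of \<open>H\<close> on it.\<close>

record ('f, 'h, 'a) alg_submod = "('f, 'a) module" +
  dsub :: "'a set"
  hact :: "'h \<Rightarrow> 'a \<Rightarrow> 'a"

definition U_ob :: "('f, 'h, 'a) alg_submod \<Rightarrow> ('h, 'a) module"
  where "U_ob A =
    \<lparr>carrier = dsub A, mult = mult A, one = one A, zero = zero A, add = add A,
     smult = hact A\<rparr>"

definition U_arr ::
  "('f, 'h, 'a) alg_submod \<Rightarrow> ('f, 'h, 'a) alg_submod \<Rightarrow> ('a \<Rightarrow> 'a) \<Rightarrow> ('a \<Rightarrow> 'a)"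
  where "U_arr A B f = restrict f (dsub A)"

text \<open>The last condition says that \<open>A\<^sub>0\<close>, as an \<open>H\<close>-module, carries the same \<open>F\<close>-space structure
  as it does as a subspace of \<open>A\<close>.\<close>

locale alg_with_submod = nonassoc_algebra F A + submodule "dsub A" F A
  for F :: "('f, 's) ring_scheme" (structure) and H :: "('f, 'h, 'n) module_scheme"
    and A :: "('f, 'h, 'a) alg_submod" (structure) +
  assumes dsub_left_module: "left_module H (U_ob A)"
    and hact_scalar:
      "\<lbrakk>c \<in> carrier F; x \<in> dsub A\<rbrakk> \<Longrightarrow> hact A (c \<odot>\<^bsub>H\<^esub> \<one>\<^bsub>H\<^esub>) x = c \<odot>\<^bsub>A\<^esub> x"

definition NAAlgSubMod ::
  "('f, 's) ring_scheme \<Rightarrow> ('f, 'h, 'n) module_scheme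
    \<Rightarrow> (('f, 'h, 'a) alg_submod, 'a \<Rightarrow> 'a) category"
  where "NAAlgSubMod F H =
    \<lparr>Ob = {A. alg_with_submod F H A},
     Hom = (\<lambda>A B. {f \<in> algebra_homs F A B.
       f ` dsub A \<subseteq> dsub B \<and> restrict f (dsub A) \<in> linear_maps H (U_ob A) (U_ob B)}),
     Ident = (\<lambda>A. restrict id (carrier A)),
     Comp = (\<lambda>A B C g f. compose (carrier A) g f)\<rparr>"


section \<open>The absolutely free nonassociative algebra\<close>

definition is_basis ::
  "('f, 's) ring_scheme \<Rightarrow> ('f, 'v, 'k) module_scheme \<Rightarrow> 'v set \<Rightarrow> bool"
  where "is_basis F V B \<longleftrightarrow> B \<subseteq> carrier V \<and>
    (\<forall>S c. finite S \<and> S \<subseteq> B \<and> c \<in> S \<rightarrow> carrier F \<and>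
       finsum V (\<lambda>b. c b \<odot>\<^bsub>V\<^esub> b) S = \<zero>\<^bsub>V\<^esub> \<longrightarrow> (\<forall>b\<in>S. c b = \<zero>\<^bsub>F\<^esub>)) \<and>
    (\<forall>v\<in>carrier V. \<exists>S c. finite S \<and> S \<subseteq> B \<and> c \<in> S \<rightarrow> carrier F \<and>
       v = finsum V (\<lambda>b. c b \<odot>\<^bsub>V\<^esub> b) S)"

definition coords ::
  "('f, 's) ring_scheme \<Rightarrow> ('f, 'v, 'k) module_scheme \<Rightarrow> 'v set \<Rightarrow> 'v \<Rightarrow> ('v \<Rightarrow> 'f)"
  where "coords F V B v = (THE c. range c \<subseteq> carrier F \<and>
    finite {b. c b \<noteq> \<zero>\<^bsub>F\<^esub>} \<and> {b. c b \<noteq> \<zero>\<^bsub>F\<^esub>} \<subseteq> B \<and>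
    v = finsum V (\<lambda>b. c b \<odot>\<^bsub>V\<^esub> b) {b. c b \<noteq> \<zero>\<^bsub>F\<^esub>})"

datatype (letters: 'b) nonassoc_word = Letter 'b | Prod "'b nonassoc_word" "'b nonassoc_word"

text \<open>The formal \<open>F\<close>-linear combinations of nonempty bracketed words over \<open>B\<close>, i.e. finitely
  supported functions on words, with the bilinear product extending \<open>Prod\<close>.  A word \<open>Prod u v\<close>
  arises as a product of words only from \<open>u\<close> and \<open>v\<close>, and a letter never does; hence the formula
  for \<open>mult\<close>.  The field \<open>one\<close> is unused.\<close>

definition free_nonassoc_algebra ::
  "('f, 's) ring_scheme \<Rightarrow> 'b set \<Rightarrow> ('f, 'b nonassoc_word \<Rightarrow> 'f) module"
  where "free_nonassoc_algebra F B =
    \<lparr>carrier = {p. range p \<subseteq> carrier F \<and> finite {w. p w \<noteq> \<zero>\<^bsub>F\<^esub>} \<and>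
                   (\<forall>w. p w \<noteq> \<zero>\<^bsub>F\<^esub> \<longrightarrow> letters w \<subseteq> B)},
     mult = (\<lambda>p q w. case w of Letter b \<Rightarrow> \<zero>\<^bsub>F\<^esub> | Prod u v \<Rightarrow> p u \<otimes>\<^bsub>F\<^esub> q v),
     one = (\<lambda>w. \<zero>\<^bsub>F\<^esub>),
     zero = (\<lambda>w. \<zero>\<^bsub>F\<^esub>),
     add = (\<lambda>p q w. p w \<oplus>\<^bsub>F\<^esub> q w),
     smult = (\<lambda>c p w. c \<otimes>\<^bsub>F\<^esub> p w)\<rparr>"

definition degree_one :: "('f, 's) ring_scheme \<Rightarrow> ('b \<Rightarrow> 'f) \<Rightarrow> ('b nonassoc_word \<Rightarrow> 'f)"
  where "degree_one F c = (\<lambda>w. case w of Letter b \<Rightarrow> c b | Prod u v \<Rightarrow> \<zero>\<^bsub>F\<^esub>)"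


section \<open>The functor \<open>K\<close>\<close>

text \<open>
  A category of all modules needs one HOL type in which the carriers of both \<open>V\<close> and \<open>K V\<close> live.
  The following type plays the role of a universe: it contains a copy of an arbitrary type \<open>'x\<close>
  of atoms, and is closed under forming formal \<open>'f\<close>-linear combinations of bracketed words.  A
  combination is coded by the finite set of its words paired with their nonzero coefficients.
  Any module or algebra with carrier in \<open>'x\<close> is isomorphic, via \<open>Atom\<close>, to one in the universe; and \<open>'x\<close>
  will be a free type variable.
\<close>

datatype ('f, 'x) universe =
    Atom 'x
  | Formal "(('f, 'x) universe nonassoc_word \<times> 'f) fset"

definition encode ::
  "('f, 's) ring_scheme \<Rightarrow> (('f, 'x) universe nonassoc_word \<Rightarrow> 'f) \<Rightarrow> ('f, 'x) universe"
  where "encode F p = Formal (Abs_fset {(w, p w) | w. p w \<noteq> \<zero>\<^bsub>F\<^esub>})"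

text \<open>Transport of structure along a map that is injective on the carrier.\<close>

definition transport :: "('a \<Rightarrow> 'b) \<Rightarrow> ('f, 'a) module \<Rightarrow> ('f, 'b) module"
  where "transport e A = (let d = inv_into (carrier A) e in
    \<lparr>carrier = e ` carrier A,
     mult = (\<lambda>x y. e (d x \<otimes>\<^bsub>A\<^esub> d y)),
     one = e \<one>\<^bsub>A\<^esub>,
     zero = e \<zero>\<^bsub>A\<^esub>,
     add = (\<lambda>x y. e (d x \<oplus>\<^bsub>A\<^esub> d y)),
     smult = (\<lambda>c x. e (c \<odot>\<^bsub>A\<^esub> d x))\<rparr>)"

definition chosen_basis ::
  "('f, 's) ring_scheme \<Rightarrow> ('f, 'h, 'n) module_scheme \<Rightarrow> ('h, 'v) module \<Rightarrow> 'v set"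
  where "chosen_basis F H V = (SOME B. is_basis F (restrict_scalars H V) B)"

text \<open>The identification of \<open>V\<close> with the degree one part of \<open>K V\<close>.\<close>

definition K_incl ::
  "('f, 's) ring_scheme \<Rightarrow> ('f, 'h, 'n) module_scheme \<Rightarrow> ('h, ('f, 'x) universe) module
    \<Rightarrow> ('f, 'x) universe \<Rightarrow> ('f, 'x) universe"
  where "K_incl F H V v =
    encode F (degree_one F (coords F (restrict_scalars H V) (chosen_basis F H V) v))"

definition K_ob ::
  "('f, 's) ring_scheme \<Rightarrow> ('f, 'h, 'n) module_scheme \<Rightarrow> ('h, ('f, 'x) universe) module
    \<Rightarrow> ('f, 'h, ('f, 'x) universe) alg_submod"
  where "K_ob F H V = module.extend
    (transport (encode F) (free_nonassoc_algebra F (chosen_basis F H V)))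
    (alg_submod.fields
      (K_incl F H V ` carrier V)
      (\<lambda>h x. K_incl F H V (h \<odot>\<^bsub>V\<^esub> inv_into (carrier V) (K_incl F H V) x)))"

text \<open>\<open>K f\<close> is the unique algebra homomorphism whose restriction to \<open>V\<close> is \<open>f\<close>.\<close>

definition K_arr ::
  "('f, 's) ring_scheme \<Rightarrow> ('f, 'h, 'n) module_scheme
    \<Rightarrow> ('h, ('f, 'x) universe) module \<Rightarrow> ('h, ('f, 'x) universe) module
    \<Rightarrow> (('f, 'x) universe \<Rightarrow> ('f, 'x) universe) \<Rightarrow> (('f, 'x) universe \<Rightarrow> ('f, 'x) universe)"
  where "K_arr F H V W f = (THE g. g \<in> algebra_homs F (K_ob F H V) (K_ob F H W) \<and>
    (\<forall>v\<in>carrier V. g (K_incl F H V v) = K_incl F H W (f v)))"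

end

theory Submission
  imports Defs
begin

text \<open>
  Let \<open>B\<close> be a basis of \<open>V\<close>.  A map from \<open>B\<close> to a nonassociative algebra \<open>A\<close> extends to bracketed
  words by evaluating the brackets in \<open>A\<close>, and then linearly to formal combinations of words;
  bilinearity makes the extension multiplicative.  An \<open>F\<close>-linear map \<open>V \<rightarrow> A\<close> is determined by
  its values on \<open>B\<close>, so it extends uniquely to an algebra homomorphism \<open>K V \<rightarrow> A\<close>.  Such a
  homomorphism is a morphism of algebras with distinguished submodule exactly when its
  restriction to \<open>V\<close> is \<open>H\<close>-linear into \<open>A\<^sub>0\<close>, so restriction along \<open>V \<rightarrow> K V\<close> is the
  required bijection; functoriality of \<open>K\<close> follows from uniqueness of the extension.
\<close>


section \<open>Formal linear combinations\<close>

text \<open>No tensor powers of V are formed. \<open>K_ob\<close> is built on a basis picked by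
  choice, so even the inclusion of V goes through coordinates. Once \<open>K_universal\<close> is
  proved, which quantifies over every element of V, the basis no longer appears. It also explains
  \<open>K_arr\<close>: an H-linear map need not send the chosen basis of V into that of W, so K
  cannot act by relabelling letters. A second obstacle is typing. V and K V must have carriers in
  one type, so formal sums are folded back into the universe by \<open>encode\<close>. The algebra
  is done with plain coefficient functions and carried over to the universe afterwards. A third
  point is the gap between two linearities: extending to K V takes a map linear over F, while the
  adjunction speaks of H-linear maps. The scalar c acts as c times the unit of H, and
  \<open>linear_maps_restrict_scalars\<close> turns this into the missing link.\<close>

definition finsupp :: "('r, 's) ring_scheme \<Rightarrow> 'i set \<Rightarrow> ('i \<Rightarrow> 'r) set"
  where "finsupp R I =
    {p. (\<forall>i. p i \<in> carrier R) \<and> finite {i. p i \<noteq> \<zero>\<^bsub>R\<^esub>} \<and> (\<forall>i. p i \<noteq> \<zero>\<^bsub>R\<^esub> \<longrightarrow> i \<in> I)}"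

definition single :: "('r, 's) ring_scheme \<Rightarrow> 'i \<Rightarrow> 'i \<Rightarrow> 'r"
  where "single R i = (\<lambda>j. if j = i then \<one>\<^bsub>R\<^esub> else \<zero>\<^bsub>R\<^esub>)"

text \<open>Summing over the exact support matches the sum inside \<open>coords\<close>. With
  \<open>e\<close> the identity this gives combinations of basis vectors; with \<open>e\<close> the
  map \<open>word_eval A f\<close> it gives the extension to formal sums of words.\<close>

definition lincomb ::
  "('r, 's) ring_scheme \<Rightarrow> ('r, 'm, 'k) module_scheme \<Rightarrow> ('i \<Rightarrow> 'm) \<Rightarrow> ('i \<Rightarrow> 'r) \<Rightarrow> 'm"
  where "lincomb R M e p = finsum M (\<lambda>i. p i \<odot>\<^bsub>M\<^esub> e i) {i. p i \<noteq> \<zero>\<^bsub>R\<^esub>}"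

lemma finsupp_closed: "p \<in> finsupp R I \<Longrightarrow> p i \<in> carrier R"
  by (auto simp: finsupp_def)

context ring
begin

lemma finsupp_zero: "(\<lambda>i. \<zero>) \<in> finsupp R I"
  by (auto simp: finsupp_def)

lemma finsupp_add:
  assumes "p \<in> finsupp R I" "q \<in> finsupp R I"
  shows "(\<lambda>i. p i \<oplus> q i) \<in> finsupp R I"
proof -
  have sub: "{i. p i \<oplus> q i \<noteq> \<zero>} \<subseteq> {i. p i \<noteq> \<zero>} \<union> {i. q i \<noteq> \<zero>}"
    by auto
  have "finite {i. p i \<oplus> q i \<noteq> \<zero>}"
    by (rule finite_subset[OF sub]) (use assms in \<open>auto simp: finsupp_def\<close>)
  then show ?thesis
    using assms sub by (auto simp: finsupp_def)
qed

lemma finsupp_smult: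
  assumes "c \<in> carrier R" "p \<in> finsupp R I"
  shows "(\<lambda>i. c \<otimes> p i) \<in> finsupp R I"
proof -
  have sub: "{i. c \<otimes> p i \<noteq> \<zero>} \<subseteq> {i. p i \<noteq> \<zero>}"
    using assms by auto
  have "finite {i. c \<otimes> p i \<noteq> \<zero>}"
    by (rule finite_subset[OF sub]) (use assms in \<open>auto simp: finsupp_def\<close>)
  then show ?thesis
    using assms sub by (auto simp: finsupp_def)
qed

lemma finsupp_single: "i \<in> I \<Longrightarrow> single R i \<in> finsupp R I"
  by (auto simp: finsupp_def single_def)

text \<open>Induction on the finite support, one index being split off at a time. The single-index
  case carries its coefficient because scaling is not among the closure steps.\<close>

lemma finsupp_induct [consumes 1, case_names zero single add]:
  fixes p :: "'i \<Rightarrow> 'a"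
  assumes p: "p \<in> finsupp R I"
    and zero: "P (\<lambda>i. \<zero>)"
    and single: "\<And>c i. c \<in> carrier R \<Longrightarrow> i \<in> I \<Longrightarrow> P (\<lambda>j. c \<otimes> single R i j)"
    and add: "\<And>p q. p \<in> finsupp R I \<Longrightarrow> q \<in> finsupp R I \<Longrightarrow> P p \<Longrightarrow> P q
      \<Longrightarrow> P (\<lambda>i. p i \<oplus> q i)"
  shows "P p"
proof -
  have "finite S \<Longrightarrow> \<forall>p \<in> finsupp R I. {i. p i \<noteq> \<zero>} = S \<longrightarrow> P p" for S
  proof (induction S rule: finite_induct)
    case empty
    show ?case
    proof (intro ballI impI)
      fix p :: "'i \<Rightarrow> 'a" assume "{i. p i \<noteq> \<zero>} = {}"
      then have "p = (\<lambda>i. \<zero>)" by auto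
      then show "P p" using zero by simp
    qed
  next
    case (insert k S)
    show ?case
    proof (intro ballI impI)
      fix p assume p: "p \<in> finsupp R I" and S: "{i. p i \<noteq> \<zero>} = insert k S"
      \<comment> \<open>\<open>q\<close> erases the entry at \<open>k\<close>, so its support is
        \<open>S\<close>, and \<open>p\<close> is \<open>q\<close> plus one scaled
        indicator.\<close>
      define q where "q = p(k := \<zero>)"
      have supp: "{i. q i \<noteq> \<zero>} = S"
        using S insert.hyps by (auto simp: q_def)
      have q: "q \<in> finsupp R I"
        using p S insert.hyps unfolding finsupp_def mem_Collect_eq supp
        by (auto simp: q_def)
      have k: "k \<in> I" "p k \<in> carrier R"
        using p S by (auto simp: finsupp_def)
      have "P (\<lambda>j. q j \<oplus> p k \<otimes> single R k j)"
        using insert.IH q supp k by (intro add single finsupp_smult finsupp_single) auto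
      also have "(\<lambda>j. q j \<oplus> p k \<otimes> single R k j) = p"
        using finsupp_closed[OF p] by (auto simp: q_def single_def)
      finally show "P p" .
    qed
  qed
  then show ?thesis using p by (auto simp: finsupp_def)
qed

end

context module
begin

text \<open>Indices outside the support contribute zero, so the support can be enlarged to any
  finite part of \<open>I\<close>. Combinations with different supports can then be added over a
  common index set.\<close>

lemma lincomb_eq_finsum:
  assumes p: "p \<in> finsupp R I" and e: "e \<in> I \<rightarrow> carrier M"
    and S: "finite S" "{i. p i \<noteq> \<zero>} \<subseteq> S" "S \<subseteq> I"
  shows "lincomb R M e p = (\<Oplus>\<^bsub>M\<^esub>i\<in>S. p i \<odot>\<^bsub>M\<^esub> e i)"
  unfolding lincomb_def
proof (rule M.add.finprod_mono_neutral_cong_left)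
  show "(\<lambda>i. p i \<odot>\<^bsub>M\<^esub> e i) \<in> S \<rightarrow> carrier M"
    using S finsupp_closed[OF p] by (auto intro!: smult_closed funcset_mem[OF e])
  show "p i \<odot>\<^bsub>M\<^esub> e i = \<zero>\<^bsub>M\<^esub>" if "i \<in> S - {i. p i \<noteq> \<zero>}" for i
  proof -
    have "e i \<in> carrier M" using that S by (auto intro!: funcset_mem[OF e])
    then show ?thesis using that by auto
  qed
qed (use S in auto)

lemma lincomb_closed:
  assumes "p \<in> finsupp R I" "e \<in> I \<rightarrow> carrier M"
  shows "lincomb R M e p \<in> carrier M"
  unfolding lincomb_def using assms(1)
  by (intro M.finsum_closed) (auto simp: finsupp_def intro!: funcset_mem[OF assms(2)])

lemma lincomb_zero: "lincomb R M e (\<lambda>i. \<zero>) = \<zero>\<^bsub>M\<^esub>"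
  by (simp add: lincomb_def)

lemma lincomb_add:
  assumes p: "p \<in> finsupp R I" and q: "q \<in> finsupp R I" and e: "e \<in> I \<rightarrow> carrier M"
  shows "lincomb R M e (\<lambda>i. p i \<oplus> q i) = lincomb R M e p \<oplus>\<^bsub>M\<^esub> lincomb R M e q"
proof -
  let ?S = "{i. p i \<noteq> \<zero>} \<union> {i. q i \<noteq> \<zero>}"
  have S: "finite ?S" "?S \<subseteq> I"
    using p q by (auto simp: finsupp_def)
  have cl: "p i \<in> carrier R" "q i \<in> carrier R" for i
    using p q by (auto simp: finsupp_def)
  have e': "e i \<in> carrier M" if "i \<in> ?S" for i
    using S that by (auto intro!: funcset_mem[OF e])
  have "lincomb R M e (\<lambda>i. p i \<oplus> q i) = (\<Oplus>\<^bsub>M\<^esub>i\<in>?S. (p i \<oplus> q i) \<odot>\<^bsub>M\<^esub> e i)"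
    by (rule lincomb_eq_finsum[OF finsupp_add[OF p q] e S(1) _ S(2)]) auto
  also have "\<dots> = (\<Oplus>\<^bsub>M\<^esub>i\<in>?S. p i \<odot>\<^bsub>M\<^esub> e i \<oplus>\<^bsub>M\<^esub> q i \<odot>\<^bsub>M\<^esub> e i)"
    using cl e' by (intro M.finsum_cong') (auto simp: smult_l_distr)
  also have "\<dots> = (\<Oplus>\<^bsub>M\<^esub>i\<in>?S. p i \<odot>\<^bsub>M\<^esub> e i) \<oplus>\<^bsub>M\<^esub> (\<Oplus>\<^bsub>M\<^esub>i\<in>?S. q i \<odot>\<^bsub>M\<^esub> e i)"
    using cl e' by (intro M.finsum_addf) auto
  also have "\<dots> = lincomb R M e p \<oplus>\<^bsub>M\<^esub> lincomb R M e q"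
    using lincomb_eq_finsum[OF p e S(1) _ S(2)] lincomb_eq_finsum[OF q e S(1) _ S(2)] by simp
  finally show ?thesis .
qed

lemma lincomb_smult:
  assumes c: "c \<in> carrier R" and p: "p \<in> finsupp R I" and e: "e \<in> I \<rightarrow> carrier M"
  shows "lincomb R M e (\<lambda>i. c \<otimes> p i) = c \<odot>\<^bsub>M\<^esub> lincomb R M e p"
proof -
  let ?S = "{i. p i \<noteq> \<zero>}"
  have S: "finite ?S" "?S \<subseteq> I"
    using p by (auto simp: finsupp_def)
  have e': "e i \<in> carrier M" if "i \<in> ?S" for i
    using S that by (auto intro!: funcset_mem[OF e])
  have "lincomb R M e (\<lambda>i. c \<otimes> p i) = (\<Oplus>\<^bsub>M\<^esub>i\<in>?S. (c \<otimes> p i) \<odot>\<^bsub>M\<^esub> e i)"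
    by (rule lincomb_eq_finsum[OF finsupp_smult[OF c p] e S(1) _ S(2)]) (use c in auto)
  also have "\<dots> = (\<Oplus>\<^bsub>M\<^esub>i\<in>?S. c \<odot>\<^bsub>M\<^esub> (p i \<odot>\<^bsub>M\<^esub> e i))"
    using c finsupp_closed[OF p] e' by (intro M.finsum_cong') (auto simp: smult_assoc1)
  also have "\<dots> = c \<odot>\<^bsub>M\<^esub> lincomb R M e p"
    unfolding lincomb_def using c finsupp_closed[OF p] e' S
    by (intro finsum_smult_ldistr[symmetric]) auto
  finally show ?thesis .
qed

lemma lincomb_single:
  assumes "e i \<in> carrier M"
  shows "lincomb R M e (single R i) = e i"
proof -
  have "lincomb R M e (single R i) = (\<Oplus>\<^bsub>M\<^esub>j\<in>{i}. single R i j \<odot>\<^bsub>M\<^esub> e j)"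
    using assms by (intro lincomb_eq_finsum[where I = "{i}"] finsupp_single) (auto simp: single_def)
  also have "\<dots> = e i"
    using assms by (simp add: M.finsum_insert single_def)
  finally show ?thesis .
qed

text \<open>The coefficients are extended by zero outside \<open>S\<close>. Agreement on
  \<open>S\<close> is recorded because linear independence is a claim about the individual
  coefficients, not only about the sum.\<close>

lemma finsum_eq_lincomb:
  assumes "finite S" "S \<subseteq> I" "c \<in> S \<rightarrow> carrier R" "e \<in> I \<rightarrow> carrier M"
  shows "\<exists>p\<in>finsupp R I. (\<Oplus>\<^bsub>M\<^esub>i\<in>S. c i \<odot>\<^bsub>M\<^esub> e i) = lincomb R M e p \<and> (\<forall>i\<in>S. p i = c i)"
proof (intro bexI conjI)
  let ?p = "\<lambda>i. if i \<in> S then c i else \<zero>"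
  have "{i. ?p i \<noteq> \<zero>} \<subseteq> S" by auto
  then have "finite {i. ?p i \<noteq> \<zero>}"
    using assms(1) by (rule finite_subset)
  then show p: "?p \<in> finsupp R I"
    using assms by (auto simp: finsupp_def)
  have "lincomb R M e ?p = (\<Oplus>\<^bsub>M\<^esub>i\<in>S. ?p i \<odot>\<^bsub>M\<^esub> e i)"
    by (rule lincomb_eq_finsum[OF p assms(4,1) _ assms(2)]) auto
  also have "\<dots> = (\<Oplus>\<^bsub>M\<^esub>i\<in>S. c i \<odot>\<^bsub>M\<^esub> e i)"
    using assms by (intro M.finsum_cong') auto
  finally show "(\<Oplus>\<^bsub>M\<^esub>i\<in>S. c i \<odot>\<^bsub>M\<^esub> e i) = lincomb R M e ?p" by simp
qed auto

text \<open>Pairs of a finite set and coefficients on it are replaced by single coefficient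
  functions. Independence becomes a trivial kernel of \<open>lincomb\<close>, and spanning becomes
  surjectivity.\<close>

lemma is_basis_iff:
  assumes "B \<subseteq> carrier M"
  shows "is_basis R M B \<longleftrightarrow>
    (\<forall>p\<in>finsupp R B. lincomb R M (\<lambda>b. b) p = \<zero>\<^bsub>M\<^esub> \<longrightarrow> p = (\<lambda>b. \<zero>)) \<and>
    lincomb R M (\<lambda>b. b) ` finsupp R B = carrier M" (is "_ \<longleftrightarrow> ?indep \<and> ?span")
proof -
  have e: "(\<lambda>b. b) \<in> B \<rightarrow> carrier M" using assms by auto
  have sums: "\<exists>S c. finite S \<and> S \<subseteq> B \<and> c \<in> S \<rightarrow> carrier R \<and>
       lincomb R M (\<lambda>b. b) p = finsum M (\<lambda>b. c b \<odot>\<^bsub>M\<^esub> b) S" if "p \<in> finsupp R B" for p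
    using that by (intro exI[of _ "{b. p b \<noteq> \<zero>}"] exI[of _ p]) (auto simp: finsupp_def lincomb_def)
  have "?indep \<longleftrightarrow> (\<forall>S c. finite S \<and> S \<subseteq> B \<and> c \<in> S \<rightarrow> carrier R \<and>
       finsum M (\<lambda>b. c b \<odot>\<^bsub>M\<^esub> b) S = \<zero>\<^bsub>M\<^esub> \<longrightarrow> (\<forall>b\<in>S. c b = \<zero>))" (is "_ \<longleftrightarrow> ?indep'")
  proof
    assume ind: ?indep
    show ?indep'
    proof (intro allI impI; elim conjE)
      fix S c assume S: "finite S" "S \<subseteq> B" "c \<in> S \<rightarrow> carrier R"
        and 0: "finsum M (\<lambda>b. c b \<odot>\<^bsub>M\<^esub> b) S = \<zero>\<^bsub>M\<^esub>"
      obtain p where p: "p \<in> finsupp R B"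
        and eq: "finsum M (\<lambda>b. c b \<odot>\<^bsub>M\<^esub> b) S = lincomb R M (\<lambda>b. b) p"
        and c: "\<forall>i\<in>S. p i = c i"
        using finsum_eq_lincomb[OF S e] by blast
      have "p = (\<lambda>b. \<zero>)" using ind p eq 0 by simp
      then show "\<forall>b\<in>S. c b = \<zero>" using c by simp
    qed
  next
    assume ind: ?indep'
    show ?indep
    proof (intro ballI impI ext)
      fix p b assume p: "p \<in> finsupp R B" and 0: "lincomb R M (\<lambda>b. b) p = \<zero>\<^bsub>M\<^esub>"
      have "finite {b. p b \<noteq> \<zero>} \<and> {b. p b \<noteq> \<zero>} \<subseteq> B \<and> p \<in> {b. p b \<noteq> \<zero>} \<rightarrow> carrier R \<and>
          finsum M (\<lambda>b. p b \<odot>\<^bsub>M\<^esub> b) {b. p b \<noteq> \<zero>} = \<zero>\<^bsub>M\<^esub>"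
        using p 0 by (auto simp: finsupp_def lincomb_def)
      from ind[THEN spec, THEN spec, THEN mp, OF this]
      show "p b = \<zero>" by blast
    qed
  qed
  moreover have "?span \<longleftrightarrow> (\<forall>v\<in>carrier M. \<exists>S c. finite S \<and> S \<subseteq> B \<and> c \<in> S \<rightarrow> carrier R \<and>
       v = finsum M (\<lambda>b. c b \<odot>\<^bsub>M\<^esub> b) S)" (is "_ \<longleftrightarrow> ?span'")
  proof
    assume ?span
    show ?span'
    proof
      fix v assume "v \<in> carrier M"
      then obtain p where p: "p \<in> finsupp R B" and v: "v = lincomb R M (\<lambda>b. b) p"
        using \<open>?span\<close> by auto
      show "\<exists>S c. finite S \<and> S \<subseteq> B \<and> c \<in> S \<rightarrow> carrier R \<and>
         v = finsum M (\<lambda>b. c b \<odot>\<^bsub>M\<^esub> b) S"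
        using sums[OF p] unfolding v .
    qed
  next
    assume span: ?span'
    have "v \<in> lincomb R M (\<lambda>b. b) ` finsupp R B" if v_in: "v \<in> carrier M" for v
    proof -
      obtain S c where S: "finite S" "S \<subseteq> B" "c \<in> S \<rightarrow> carrier R"
        and v: "v = finsum M (\<lambda>b. c b \<odot>\<^bsub>M\<^esub> b) S"
        using bspec[OF span v_in] by (elim exE conjE)
      obtain p where "p \<in> finsupp R B"
        "finsum M (\<lambda>b. c b \<odot>\<^bsub>M\<^esub> b) S = lincomb R M (\<lambda>b. b) p"
        using finsum_eq_lincomb[OF S e] by blast
      then show ?thesis using v by simp
    qed
    then show ?span using lincomb_closed[OF _ e] by auto
  qed
  ultimately show ?thesis using assms unfolding is_basis_def by simp
qed

end


section \<open>Bases and coordinates\<close>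

text \<open>Zorn's lemma yields a maximal independent set, and a vector outside its span could still
  be adjoined. Division enters here: a relation with nonzero coefficient at the new vector is solved
  for that vector.\<close>

lemma (in module) exists_basis:
  assumes "field R"
  shows "\<exists>B. is_basis R M B"
proof -
  interpret field R by fact
  define indep where "indep B \<longleftrightarrow> B \<subseteq> carrier M \<and>
    (\<forall>p\<in>finsupp R B. lincomb R M (\<lambda>b. b) p = \<zero>\<^bsub>M\<^esub> \<longrightarrow> p = (\<lambda>b. \<zero>))" for B
  have "\<exists>B\<in>Collect indep. \<forall>X\<in>Collect indep. B \<subseteq> X \<longrightarrow> X = B"
  proof (rule subset_Zorn_nonempty)
    have "indep {}" by (auto simp: indep_def finsupp_def)
    then show "Collect indep \<noteq> {}" by blast
  next
    fix \<C> assume ne: "\<C> \<noteq> {}" and chain: "subset.chain (Collect indep) \<C>"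
    have sub: "\<C> \<subseteq> Collect indep" using chain by (simp add: subset_chain_def)
    have "p = (\<lambda>b. \<zero>)"
      if p: "p \<in> finsupp R (\<Union>\<C>)" and 0: "lincomb R M (\<lambda>b. b) p = \<zero>\<^bsub>M\<^esub>" for p
    proof -
      have fin: "finite {b. p b \<noteq> \<zero>}" and cover: "{b. p b \<noteq> \<zero>} \<subseteq> \<Union>\<C>"
        using p by (auto simp: finsupp_def)
      \<comment> \<open>A relation has finite support, which lies in one member of the chain, so it
        is already a relation within an independent set.\<close>
      obtain B where B: "B \<in> \<C>" "{b. p b \<noteq> \<zero>} \<subseteq> B"
        by (rule finite_subset_Union_chain[OF fin cover ne chain])
      then have "p \<in> finsupp R B" "indep B" using p sub by (auto simp: finsupp_def)
      then show ?thesis using 0 by (simp add: indep_def)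
    qed
    moreover have "\<Union>\<C> \<subseteq> carrier M"
      using sub unfolding indep_def by blast
    ultimately show "\<Union>\<C> \<in> Collect indep" by (simp add: indep_def)
  qed
  then obtain B where B: "indep B" and max: "\<And>X. indep X \<Longrightarrow> B \<subseteq> X \<Longrightarrow> X = B"
    by auto
  have sub: "B \<subseteq> carrier M" using B by (simp add: indep_def)
  then have e: "(\<lambda>b. b) \<in> B \<rightarrow> carrier M" by auto
  have "v \<in> lincomb R M (\<lambda>b. b) ` finsupp R B" if v: "v \<in> carrier M" for v
  proof (rule ccontr)
    assume v_notin: "v \<notin> lincomb R M (\<lambda>b. b) ` finsupp R B"
    have e': "(\<lambda>b. b) \<in> insert v B \<rightarrow> carrier M" using e v by auto
    have "p = (\<lambda>b. \<zero>)"
      if p: "p \<in> finsupp R (insert v B)" and 0: "lincomb R M (\<lambda>b. b) p = \<zero>\<^bsub>M\<^esub>" for p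
    proof (cases "p v = \<zero>")
      case True
      then have "p \<in> finsupp R B" using p by (auto simp: finsupp_def)
      then show ?thesis using B 0 by (simp add: indep_def)
    next
      case False
      \<comment> \<open>The relation splits as the part \<open>q\<close> over \<open>B\<close> plus
        \<open>c\<close> times \<open>v\<close>. As \<open>c\<close> is invertible, \<open>v\<close>
        becomes a combination of \<open>B\<close>, contrary to its choice.\<close>
      define q where "q = p(v := \<zero>)"
      define c where "c = p v"
      have c: "c \<in> carrier R" "c \<noteq> \<zero>" using p False by (auto simp: finsupp_def c_def)
      then have d: "inv c \<in> carrier R" "inv c \<otimes> c = \<one>" by (simp_all add: field_Units)
      have "{b. q b \<noteq> \<zero>} \<subseteq> {b. p b \<noteq> \<zero>}" by (auto simp: q_def)
      then have "finite {b. q b \<noteq> \<zero>}" by (rule finite_subset) (use p in \<open>simp add: finsupp_def\<close>)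
      then have q: "q \<in> finsupp R B" using p by (auto simp: finsupp_def q_def)
      then have q': "q \<in> finsupp R (insert v B)" by (auto simp: finsupp_def)
      let ?L = "lincomb R M (\<lambda>b. b) q"
      have L: "?L \<in> carrier M" using lincomb_closed[OF q e] .
      have s: "single R v \<in> finsupp R (insert v B)" by (rule finsupp_single) simp
      have "p = (\<lambda>b. q b \<oplus> c \<otimes> single R v b)"
        using finsupp_closed[OF p] by (auto simp: q_def c_def single_def)
      then have "?L \<oplus>\<^bsub>M\<^esub> c \<odot>\<^bsub>M\<^esub> v = \<zero>\<^bsub>M\<^esub>"
        using 0 lincomb_add[OF q' finsupp_smult[OF c(1) s] e'] lincomb_smult[OF c(1) s e']
          lincomb_single[of "\<lambda>b. b" v] v by simp
      then have "inv c \<odot>\<^bsub>M\<^esub> (?L \<oplus>\<^bsub>M\<^esub> c \<odot>\<^bsub>M\<^esub> v) = \<zero>\<^bsub>M\<^esub>"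
        using d by simp
      then have "inv c \<odot>\<^bsub>M\<^esub> ?L \<oplus>\<^bsub>M\<^esub> v = \<zero>\<^bsub>M\<^esub>"
        using c d L v by (simp add: smult_r_distr smult_assoc1[symmetric])
      then have "v = (\<ominus> (inv c)) \<odot>\<^bsub>M\<^esub> ?L"
        using d L v by (metis M.a_comm M.minus_equality smult_closed smult_l_minus)
      also have "\<dots> = lincomb R M (\<lambda>b. b) (\<lambda>b. (\<ominus> (inv c)) \<otimes> q b)"
        using lincomb_smult[OF _ q e] d by simp
      finally have "v \<in> lincomb R M (\<lambda>b. b) ` finsupp R B"
        using finsupp_smult[OF _ q, of "\<ominus> (inv c)"] d by auto
      then show ?thesis using v_notin by contradiction
    qed
    then have "indep (insert v B)" using sub v by (auto simp: indep_def)
    then have "v \<in> B" using max[of "insert v B"] by auto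
    then show False
      using v_notin lincomb_single[of "\<lambda>b. b" v] v finsupp_single[of v B]
      by (metis image_eqI)
  qed
  then have "lincomb R M (\<lambda>b. b) ` finsupp R B = carrier M"
    using lincomb_closed[OF _ e] by auto
  then have "is_basis R M B"
    using B unfolding is_basis_iff[OF sub] by (simp add: indep_def)
  then show ?thesis by blast
qed

section \<open>Coordinates with respect to a fixed basis\<close>

locale module_with_basis = module +
  fixes B
  assumes basis: "is_basis R M B"
begin

lemma basis_subset: "B \<subseteq> carrier M"
  using basis by (simp add: is_basis_def)

lemma basis_fun: "(\<lambda>b. b) \<in> B \<rightarrow> carrier M"
  using basis_subset by auto

text \<open>The difference of \<open>p\<close> and \<open>q\<close> has zero combination, so
  independence kills it. Writing it with the scalar -1 keeps it within the operations for which
  \<open>lincomb\<close> is known to be linear.\<close>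

lemma lincomb_basis_inj:
  assumes p: "p \<in> finsupp R B" and q: "q \<in> finsupp R B"
    and eq: "lincomb R M (\<lambda>b. b) p = lincomb R M (\<lambda>b. b) q"
  shows "p = q"
proof -
  have m1: "\<ominus> \<one> \<in> carrier R" by simp
  note q' = finsupp_smult[OF m1 q]
  have "lincomb R M (\<lambda>b. b) (\<lambda>i. p i \<oplus> \<ominus> \<one> \<otimes> q i) = \<zero>\<^bsub>M\<^esub>"
    using lincomb_closed[OF q basis_fun]
    by (simp add: lincomb_add[OF p q' basis_fun] lincomb_smult[OF m1 q basis_fun] eq
        smult_l_minus M.r_neg)
  then have "(\<lambda>i. p i \<oplus> \<ominus> \<one> \<otimes> q i) = (\<lambda>i. \<zero>)"
    using basis finsupp_add[OF p q'] unfolding is_basis_iff[OF basis_subset] by blast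
  then have "p i \<oplus> \<ominus> (q i) = \<zero>" for i
    using finsupp_closed[OF q] by (simp add: R.l_minus fun_eq_iff)
  then show ?thesis
    using finsupp_closed[OF p] finsupp_closed[OF q]
    by (metis R.add.inv_solve_right R.l_zero R.zero_closed ext)
qed

text \<open>Injectivity of \<open>lincomb\<close> makes the coefficient function unique, so the
  definite description in \<open>coords\<close> denotes it.\<close>

lemma coords_lincomb:
  assumes p: "p \<in> finsupp R B"
  shows "coords R M B (lincomb R M (\<lambda>b. b) p) = p"
proof -
  have finsupp: "c \<in> finsupp R B \<longleftrightarrow>
      range c \<subseteq> carrier R \<and> finite {b. c b \<noteq> \<zero>} \<and> {b. c b \<noteq> \<zero>} \<subseteq> B" for c
    by (auto simp: finsupp_def)
  show ?thesis
    unfolding coords_def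
    by (rule the_equality; unfold lincomb_def[symmetric])
      (use p lincomb_basis_inj in \<open>auto simp: finsupp\<close>)
qed

lemma coords:
  assumes "v \<in> carrier M"
  shows coords_finsupp: "coords R M B v \<in> finsupp R B"
    and lincomb_coords: "lincomb R M (\<lambda>b. b) (coords R M B v) = v"
proof -
  obtain p where "p \<in> finsupp R B" "v = lincomb R M (\<lambda>b. b) p"
    using assms basis unfolding is_basis_iff[OF basis_subset] by blast
  then show "coords R M B v \<in> finsupp R B" "lincomb R M (\<lambda>b. b) (coords R M B v) = v"
    by (simp_all add: coords_lincomb)
qed

lemma coords_add:
  assumes "v \<in> carrier M" "w \<in> carrier M"
  shows "coords R M B (v \<oplus>\<^bsub>M\<^esub> w) = (\<lambda>b. coords R M B v b \<oplus> coords R M B w b)"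
  using coords_lincomb[OF finsupp_add[OF assms[THEN coords_finsupp]]]
  by (simp add: lincomb_add[OF assms[THEN coords_finsupp] basis_fun] lincomb_coords assms)

lemma coords_smult:
  assumes "c \<in> carrier R" "v \<in> carrier M"
  shows "coords R M B (c \<odot>\<^bsub>M\<^esub> v) = (\<lambda>b. c \<otimes> coords R M B v b)"
  using coords_lincomb[OF finsupp_smult[OF assms(1) coords_finsupp[OF assms(2)]]]
  by (simp add: lincomb_smult[OF assms(1) coords_finsupp[OF assms(2)] basis_fun]
      lincomb_coords assms)

lemma coords_basis: "b \<in> B \<Longrightarrow> coords R M B b = single R b"
  using coords_lincomb[OF finsupp_single] basis_subset by (simp add: lincomb_single subset_iff)

lemma coords_inj: "inj_on (coords R M B) (carrier M)"
  by (metis inj_onI lincomb_coords)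

end


section \<open>The free nonassociative algebra\<close>

lemma free_nonassoc_algebra_simps [simp]:
  "carrier (free_nonassoc_algebra R B) = finsupp R {w. letters w \<subseteq> B}"
  "\<zero>\<^bsub>free_nonassoc_algebra R B\<^esub> = (\<lambda>w. \<zero>\<^bsub>R\<^esub>)"
  "p \<oplus>\<^bsub>free_nonassoc_algebra R B\<^esub> q = (\<lambda>w. p w \<oplus>\<^bsub>R\<^esub> q w)"
  "c \<odot>\<^bsub>free_nonassoc_algebra R B\<^esub> p = (\<lambda>w. c \<otimes>\<^bsub>R\<^esub> p w)"
  "p \<otimes>\<^bsub>free_nonassoc_algebra R B\<^esub> q =
    (\<lambda>w. case w of Letter b \<Rightarrow> \<zero>\<^bsub>R\<^esub> | Prod u v \<Rightarrow> p u \<otimes>\<^bsub>R\<^esub> q v)"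
  by (auto simp: free_nonassoc_algebra_def finsupp_def)

context cring
begin

lemma free_abelian_group: "abelian_group (free_nonassoc_algebra R B)"
proof (rule abelian_groupI)
  let ?A = "free_nonassoc_algebra R B"
  fix p assume p: "p \<in> carrier ?A"
  \<comment> \<open>The additive inverse is taken as the scalar multiple by -1, so that finiteness
    of its support is already known.\<close>
  have "(\<lambda>w. \<ominus> \<one> \<otimes> p w) \<in> carrier ?A" using finsupp_smult[of "\<ominus> \<one>"] p by simp
  moreover have "(\<lambda>w. \<ominus> \<one> \<otimes> p w) \<oplus>\<^bsub>?A\<^esub> p = \<zero>\<^bsub>?A\<^esub>"
    using p by (auto simp: finsupp_def l_minus l_neg)
  ultimately show "\<exists>q\<in>carrier ?A. q \<oplus>\<^bsub>?A\<^esub> p = \<zero>\<^bsub>?A\<^esub>" by blast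
qed (auto simp: finsupp_add finsupp_zero, auto simp: finsupp_def a_ac)

lemma free_module: "module R (free_nonassoc_algebra R B)"
  by (rule moduleI[OF is_cring free_abelian_group])
    (auto simp: finsupp_smult, auto simp: finsupp_def l_distr r_distr m_assoc)

text \<open>A word in the support of the product is \<open>Prod u v\<close> with \<open>u\<close>
  and \<open>v\<close> in the two supports, which leaves finitely many words, all with letters in
  \<open>B\<close>.\<close>

lemma free_mult_closed:
  assumes p: "p \<in> carrier (free_nonassoc_algebra R B)" and q: "q \<in> carrier (free_nonassoc_algebra R B)"
  shows "p \<otimes>\<^bsub>free_nonassoc_algebra R B\<^esub> q \<in> carrier (free_nonassoc_algebra R B)"
    (is "?pq \<in> _")
proof -
  have cl: "p w \<in> carrier R" "q w \<in> carrier R" for w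
    using p q by (auto simp: finsupp_def)
  have supp: "{w. ?pq w \<noteq> \<zero>} \<subseteq> (\<lambda>(u, v). Prod u v) ` ({u. p u \<noteq> \<zero>} \<times> {v. q v \<noteq> \<zero>})"
  proof
    fix w assume "w \<in> {w. ?pq w \<noteq> \<zero>}"
    then show "w \<in> (\<lambda>(u, v). Prod u v) ` ({u. p u \<noteq> \<zero>} \<times> {v. q v \<noteq> \<zero>})"
      using cl by (cases w) auto
  qed
  then have "finite {w. ?pq w \<noteq> \<zero>}"
    by (rule finite_subset) (use p q in \<open>auto simp: finsupp_def\<close>)
  moreover have "?pq w \<in> carrier R" for w
    using cl by (cases w) auto
  moreover have "letters w \<subseteq> B" if nz: "?pq w \<noteq> \<zero>" for w
  proof -
    have "w \<in> {w. ?pq w \<noteq> \<zero>}" using nz by (rule CollectI)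
    from subsetD[OF supp this]
    obtain u v where w: "w = Prod u v" "p u \<noteq> \<zero>" "q v \<noteq> \<zero>" by auto
    then have "letters u \<subseteq> B" "letters v \<subseteq> B"
      using p q by (simp_all add: finsupp_def)
    then show ?thesis using w by simp
  qed
  ultimately show ?thesis by (simp add: finsupp_def)
qed

lemma free_nonassoc_algebra: "nonassoc_algebra R (free_nonassoc_algebra R B)"
proof (intro nonassoc_algebra.intro free_module nonassoc_algebra_axioms.intro free_mult_closed)
qed (auto simp: finsupp_def l_distr r_distr m_assoc m_lcomm fun_eq_iff split: nonassoc_word.split)

lemma single_mult_single:
  "single R u \<otimes>\<^bsub>free_nonassoc_algebra R B\<^esub> single R v = single R (Prod u v)"
  by (auto simp: single_def fun_eq_iff split: nonassoc_word.split)

text \<open>Letters generate: indicators of words arise from letters by products, following the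
  brackets, and all formal sums arise from these by linearity.\<close>

lemma free_nonassoc_algebra_induct [consumes 1, case_names zero letter add smult mult]:
  assumes p: "p \<in> carrier (free_nonassoc_algebra R B)"
    and zero: "P (\<lambda>w. \<zero>)"
    and letter: "\<And>b. b \<in> B \<Longrightarrow> P (single R (Letter b))"
    and add: "\<And>p q. p \<in> carrier (free_nonassoc_algebra R B) \<Longrightarrow>
      q \<in> carrier (free_nonassoc_algebra R B) \<Longrightarrow> P p \<Longrightarrow> P q \<Longrightarrow>
      P (p \<oplus>\<^bsub>free_nonassoc_algebra R B\<^esub> q)"
    and smult: "\<And>c p. c \<in> carrier R \<Longrightarrow> p \<in> carrier (free_nonassoc_algebra R B) \<Longrightarrow> P p \<Longrightarrow>
      P (c \<odot>\<^bsub>free_nonassoc_algebra R B\<^esub> p)"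
    and mult: "\<And>p q. p \<in> carrier (free_nonassoc_algebra R B) \<Longrightarrow>
      q \<in> carrier (free_nonassoc_algebra R B) \<Longrightarrow> P p \<Longrightarrow> P q \<Longrightarrow>
      P (p \<otimes>\<^bsub>free_nonassoc_algebra R B\<^esub> q)"
  shows "P p"
proof -
  have word: "letters w \<subseteq> B \<Longrightarrow> P (single R w)" for w
  proof (induction w)
    case (Letter b)
    then show ?case by (intro letter) simp
  next
    case (Prod u v)
    then have "P (single R u \<otimes>\<^bsub>free_nonassoc_algebra R B\<^esub> single R v)"
      by (intro mult) (auto simp: finsupp_single)
    then show ?case by (simp only: single_mult_single)
  qed
  have "p \<in> finsupp R {w. letters w \<subseteq> B}" using p by simp
  then show ?thesis
  proof (induction p rule: finsupp_induct)
    case zero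
    then show ?case by (rule assms(2))
  next
    case (single c w)
    then have "P (c \<odot>\<^bsub>free_nonassoc_algebra R B\<^esub> single R w)"
      by (intro smult word) (auto simp: finsupp_single)
    then show ?case by simp
  next
    case (add p q)
    then show ?case using assms(4)[of p q] by simp
  qed
qed

end

section \<open>Evaluation of words and homomorphisms out of the free algebra\<close>

context nonassoc_algebra
begin

text \<open>Zero is its own multiple by the scalar zero, and that scalar can be moved outside the
  product.\<close>

lemma mult_l_null: "x \<in> carrier A \<Longrightarrow> \<zero>\<^bsub>A\<^esub> \<otimes>\<^bsub>A\<^esub> x = \<zero>\<^bsub>A\<^esub>"
  using smult_mult_left[of "\<zero>" "\<zero>\<^bsub>A\<^esub>" x] by (simp add: mult_closed)

lemma mult_r_null: "x \<in> carrier A \<Longrightarrow> x \<otimes>\<^bsub>A\<^esub> \<zero>\<^bsub>A\<^esub> = \<zero>\<^bsub>A\<^esub>"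
  using smult_mult_right[of "\<zero>" x "\<zero>\<^bsub>A\<^esub>"] by (simp add: mult_closed)

end

primrec word_eval :: "('r, 'a, 'k) module_scheme \<Rightarrow> ('b \<Rightarrow> 'a) \<Rightarrow> 'b nonassoc_word \<Rightarrow> 'a"
  where
    "word_eval A f (Letter b) = f b"
  | "word_eval A f (Prod u v) = word_eval A f u \<otimes>\<^bsub>A\<^esub> word_eval A f v"

text \<open>The restriction makes the map extensional, as membership in \<open>algebra_homs\<close>
  demands.\<close>

definition free_lift ::
  "('r, 's) ring_scheme \<Rightarrow> 'b set \<Rightarrow> ('r, 'a, 'k) module_scheme \<Rightarrow> ('b \<Rightarrow> 'a)
    \<Rightarrow> ('b nonassoc_word \<Rightarrow> 'r) \<Rightarrow> 'a"
  where "free_lift R B A f =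
    restrict (lincomb R A (word_eval A f)) (carrier (free_nonassoc_algebra R B))"

context nonassoc_algebra
begin

lemma word_eval_closed:
  assumes "f \<in> B \<rightarrow> carrier A" "letters w \<subseteq> B"
  shows "word_eval A f w \<in> carrier A"
  using assms(2) by (induction w) (auto intro!: mult_closed funcset_mem[OF assms(1)])

text \<open>Sums and scalars are linearity of \<open>lincomb\<close>. For products both sides are
  bilinear, which reduces the claim to two words, where it is the recursion of
  \<open>word_eval\<close>.\<close>

lemma free_lift_hom:
  assumes f: "f \<in> B \<rightarrow> carrier A"
  shows "free_lift F B A f \<in> algebra_homs F (free_nonassoc_algebra F B) A"
proof -
  let ?E = "free_nonassoc_algebra F B" and ?W = "{w. letters w \<subseteq> B}"
  let ?L = "lincomb F A (word_eval A f)"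
  interpret E: nonassoc_algebra F ?E by (rule R.free_nonassoc_algebra)
  have e: "word_eval A f \<in> ?W \<rightarrow> carrier A" using word_eval_closed[OF f] by auto
  have closed: "?L p \<in> carrier A" if "p \<in> carrier ?E" for p
    using lincomb_closed[OF _ e] that by simp
  have zero: "?L \<zero>\<^bsub>?E\<^esub> = \<zero>\<^bsub>A\<^esub>"
    by (simp add: lincomb_zero)
  have add: "?L (p \<oplus>\<^bsub>?E\<^esub> q) = ?L p \<oplus>\<^bsub>A\<^esub> ?L q" if "p \<in> carrier ?E" "q \<in> carrier ?E" for p q
    using lincomb_add[OF _ _ e] that by simp
  have smult: "?L (c \<odot>\<^bsub>?E\<^esub> p) = c \<odot>\<^bsub>A\<^esub> ?L p" if "c \<in> carrier F" "p \<in> carrier ?E" for c p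
    using lincomb_smult[OF _ _ e] that by simp
  have word: "?L (single F w) = word_eval A f w" if "w \<in> ?W" for w
    using that by (intro lincomb_single word_eval_closed[OF f]) simp
  \<comment> \<open>The induction rule is restated with the operations of the algebra itself, so
    that its bilinearity laws fit the cases directly.\<close>
  have induct: "P p" if p: "p \<in> carrier ?E" and 0: "P \<zero>\<^bsub>?E\<^esub>"
    and single: "\<And>c w. c \<in> carrier F \<Longrightarrow> w \<in> ?W \<Longrightarrow> P (c \<odot>\<^bsub>?E\<^esub> single F w)"
    and add: "\<And>p q. p \<in> carrier ?E \<Longrightarrow> q \<in> carrier ?E \<Longrightarrow> P p \<Longrightarrow> P q \<Longrightarrow> P (p \<oplus>\<^bsub>?E\<^esub> q)"
    for P p
    using R.finsupp_induct[of p ?W P] that by simp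
  have s: "single F w \<in> carrier ?E" if "w \<in> ?W" for w
    using R.finsupp_single[OF that] by simp
  have cs: "c \<odot>\<^bsub>?E\<^esub> single F w \<in> carrier ?E" if "c \<in> carrier F" "w \<in> ?W" for c w
    using that by (intro E.smult_closed s)
  \<comment> \<open>The left factor is a scaled word and the right factor runs through the
    induction. A second induction, on the left factor, then gives the general product.\<close>
  have mult1: "?L ((c \<odot>\<^bsub>?E\<^esub> single F u) \<otimes>\<^bsub>?E\<^esub> q) = ?L (c \<odot>\<^bsub>?E\<^esub> single F u) \<otimes>\<^bsub>A\<^esub> ?L q"
    if c: "c \<in> carrier F" and u: "u \<in> ?W" and q: "q \<in> carrier ?E" for c u q
    using q
  proof (rule induct)
    show "?L ((c \<odot>\<^bsub>?E\<^esub> single F u) \<otimes>\<^bsub>?E\<^esub> \<zero>\<^bsub>?E\<^esub>) = ?L (c \<odot>\<^bsub>?E\<^esub> single F u) \<otimes>\<^bsub>A\<^esub> ?L \<zero>\<^bsub>?E\<^esub>"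
      unfolding E.mult_r_null[OF cs[OF c u]] zero mult_r_null[OF closed[OF cs[OF c u]]] ..
  next
    fix d v assume d: "d \<in> carrier F" and v: "v \<in> ?W"
    have uv: "Prod u v \<in> ?W" using u v by simp
    have "?L ((c \<odot>\<^bsub>?E\<^esub> single F u) \<otimes>\<^bsub>?E\<^esub> (d \<odot>\<^bsub>?E\<^esub> single F v)) =
        ?L (c \<odot>\<^bsub>?E\<^esub> (d \<odot>\<^bsub>?E\<^esub> single F (Prod u v)))"
      unfolding E.smult_mult_left[OF c s[OF u] cs[OF d v]] E.smult_mult_right[OF d s[OF u] s[OF v]]
        R.single_mult_single ..
    also have "\<dots> = c \<odot>\<^bsub>A\<^esub> (d \<odot>\<^bsub>A\<^esub> (word_eval A f u \<otimes>\<^bsub>A\<^esub> word_eval A f v))"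
      unfolding smult[OF c cs[OF d uv]] smult[OF d s[OF uv]] word[OF uv] by simp
    also have "\<dots> = ?L (c \<odot>\<^bsub>?E\<^esub> single F u) \<otimes>\<^bsub>A\<^esub> ?L (d \<odot>\<^bsub>?E\<^esub> single F v)"
      unfolding smult[OF c s[OF u]] smult[OF d s[OF v]] word[OF u] word[OF v]
      using c d u v word_eval_closed[OF f] 
      by (simp add: smult_mult_left smult_mult_right mult_closed smult_assoc1[symmetric] R.m_comm)
    finally show "?L ((c \<odot>\<^bsub>?E\<^esub> single F u) \<otimes>\<^bsub>?E\<^esub> (d \<odot>\<^bsub>?E\<^esub> single F v)) =
      ?L (c \<odot>\<^bsub>?E\<^esub> single F u) \<otimes>\<^bsub>A\<^esub> ?L (d \<odot>\<^bsub>?E\<^esub> single F v)" .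
  next
    fix p q assume p: "p \<in> carrier ?E" and q: "q \<in> carrier ?E"
      and IH: "?L ((c \<odot>\<^bsub>?E\<^esub> single F u) \<otimes>\<^bsub>?E\<^esub> p) = ?L (c \<odot>\<^bsub>?E\<^esub> single F u) \<otimes>\<^bsub>A\<^esub> ?L p"
        "?L ((c \<odot>\<^bsub>?E\<^esub> single F u) \<otimes>\<^bsub>?E\<^esub> q) = ?L (c \<odot>\<^bsub>?E\<^esub> single F u) \<otimes>\<^bsub>A\<^esub> ?L q"
    show "?L ((c \<odot>\<^bsub>?E\<^esub> single F u) \<otimes>\<^bsub>?E\<^esub> (p \<oplus>\<^bsub>?E\<^esub> q)) =
      ?L (c \<odot>\<^bsub>?E\<^esub> single F u) \<otimes>\<^bsub>A\<^esub> ?L (p \<oplus>\<^bsub>?E\<^esub> q)"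
      unfolding E.mult_r_distr[OF cs[OF c u] p q] add[OF p q] IH
        add[OF E.mult_closed[OF cs[OF c u] p] E.mult_closed[OF cs[OF c u] q]]
        mult_r_distr[OF closed[OF cs[OF c u]] closed[OF p] closed[OF q]] ..
  qed
  have mult: "?L (p \<otimes>\<^bsub>?E\<^esub> q) = ?L p \<otimes>\<^bsub>A\<^esub> ?L q" if p: "p \<in> carrier ?E" and q: "q \<in> carrier ?E" for p q
    using p
  proof (rule induct)
    show "?L (\<zero>\<^bsub>?E\<^esub> \<otimes>\<^bsub>?E\<^esub> q) = ?L \<zero>\<^bsub>?E\<^esub> \<otimes>\<^bsub>A\<^esub> ?L q"
      unfolding E.mult_l_null[OF q] zero mult_l_null[OF closed[OF q]] ..
  next
    fix p p' assume p: "p \<in> carrier ?E" and p': "p' \<in> carrier ?E"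
      and IH: "?L (p \<otimes>\<^bsub>?E\<^esub> q) = ?L p \<otimes>\<^bsub>A\<^esub> ?L q" "?L (p' \<otimes>\<^bsub>?E\<^esub> q) = ?L p' \<otimes>\<^bsub>A\<^esub> ?L q"
    show "?L ((p \<oplus>\<^bsub>?E\<^esub> p') \<otimes>\<^bsub>?E\<^esub> q) = ?L (p \<oplus>\<^bsub>?E\<^esub> p') \<otimes>\<^bsub>A\<^esub> ?L q"
      unfolding E.mult_l_distr[OF p p' q] add[OF p p'] IH
        add[OF E.mult_closed[OF p q] E.mult_closed[OF p' q]]
        mult_l_distr[OF closed[OF p] closed[OF p'] closed[OF q]] ..
  qed (rule mult1[OF _ _ q])
  note cl = E.a_closed E.smult_closed E.mult_closed
  show ?thesis
    unfolding algebra_homs_def linear_maps_def free_lift_def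
    by (auto simp del: free_nonassoc_algebra_simps simp: closed add smult mult cl)
qed

lemma free_lift_letter:
  assumes f: "f \<in> B \<rightarrow> carrier A" and b: "b \<in> B"
  shows "free_lift F B A f (single F (Letter b)) = f b"
  using b funcset_mem[OF f b] lincomb_single[of "word_eval A f" "Letter b"]
  by (simp add: free_lift_def R.finsupp_single)

end

lemma algebra_homsD:
  assumes "g \<in> algebra_homs F A C"
  shows "\<And>x. x \<in> carrier A \<Longrightarrow> g x \<in> carrier C"
    and "\<And>x y. x \<in> carrier A \<Longrightarrow> y \<in> carrier A \<Longrightarrow> g (x \<oplus>\<^bsub>A\<^esub> y) = g x \<oplus>\<^bsub>C\<^esub> g y"
    and "\<And>c x. c \<in> carrier F \<Longrightarrow> x \<in> carrier A \<Longrightarrow> g (c \<odot>\<^bsub>A\<^esub> x) = c \<odot>\<^bsub>C\<^esub> g x"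
    and "\<And>x y. x \<in> carrier A \<Longrightarrow> y \<in> carrier A \<Longrightarrow> g (x \<otimes>\<^bsub>A\<^esub> y) = g x \<otimes>\<^bsub>C\<^esub> g y"
    and "g \<in> extensional (carrier A)"
  using assms by (auto simp: algebra_homs_def linear_maps_def PiE_def)

lemma algebra_homs_zero:
  assumes "module F A" "module F C" "g \<in> algebra_homs F A C"
  shows "g \<zero>\<^bsub>A\<^esub> = \<zero>\<^bsub>C\<^esub>"
proof -
  interpret A: module F A by fact
  interpret C: module F C by fact
  have "g (\<zero>\<^bsub>F\<^esub> \<odot>\<^bsub>A\<^esub> \<zero>\<^bsub>A\<^esub>) = \<zero>\<^bsub>F\<^esub> \<odot>\<^bsub>C\<^esub> g \<zero>\<^bsub>A\<^esub>"
    using algebra_homsD(3)[OF assms(3)] by blast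
  then show ?thesis using algebra_homsD(1)[OF assms(3)] by simp
qed

text \<open>The elements where \<open>g\<close> and \<open>h\<close> agree are closed under all
  operations and include the letters, which generate. Off the carrier both are
  \<open>undefined\<close>.\<close>

lemma free_homs_eqI:
  assumes A: "nonassoc_algebra F A"
    and g: "g \<in> algebra_homs F (free_nonassoc_algebra F B) A"
    and h: "h \<in> algebra_homs F (free_nonassoc_algebra F B) A"
    and eq: "\<And>b. b \<in> B \<Longrightarrow> g (single F (Letter b)) = h (single F (Letter b))"
  shows "g = h"
proof (rule extensionalityI[OF algebra_homsD(5)[OF g] algebra_homsD(5)[OF h]])
  interpret A: nonassoc_algebra F A by fact
  note mod = A.R.free_module A.module_axioms
  fix p assume "p \<in> carrier (free_nonassoc_algebra F B)"
  then show "g p = h p"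
  proof (induction p rule: A.R.free_nonassoc_algebra_induct)
    case zero
    show ?case using algebra_homs_zero[OF mod g] algebra_homs_zero[OF mod h] by simp
  qed (use eq in \<open>simp_all only: algebra_homsD(2-4)[OF g] algebra_homsD(2-4)[OF h]\<close>)
qed


section \<open>The degree one part and the universal property of the free algebra\<close>

lemma linear_mapsD:
  assumes "f \<in> linear_maps R V W"
  shows "\<And>x. x \<in> carrier V \<Longrightarrow> f x \<in> carrier W"
    and "\<And>x y. x \<in> carrier V \<Longrightarrow> y \<in> carrier V \<Longrightarrow> f (x \<oplus>\<^bsub>V\<^esub> y) = f x \<oplus>\<^bsub>W\<^esub> f y"
    and "\<And>r x. r \<in> carrier R \<Longrightarrow> x \<in> carrier V \<Longrightarrow> f (r \<odot>\<^bsub>V\<^esub> x) = r \<odot>\<^bsub>W\<^esub> f x"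
    and "f \<in> extensional (carrier V)"
  using assms by (auto simp: linear_maps_def PiE_def)

lemma (in cring) degree_one_closed:
  assumes "p \<in> finsupp R B"
  shows "degree_one R p \<in> carrier (free_nonassoc_algebra R B)"
proof -
  have "{w. degree_one R p w \<noteq> \<zero>} \<subseteq> Letter ` {b. p b \<noteq> \<zero>}"
  proof
    fix w assume "w \<in> {w. degree_one R p w \<noteq> \<zero>}"
    then show "w \<in> Letter ` {b. p b \<noteq> \<zero>}"
      by (cases w) (auto simp: degree_one_def)
  qed
  then have "finite {w. degree_one R p w \<noteq> \<zero>}"
    by (rule finite_subset) (use assms in \<open>simp add: finsupp_def\<close>)
  then show ?thesis
    using assms by (auto simp: finsupp_def degree_one_def split: nonassoc_word.splits)
qed

lemma (in cring) degree_one_add: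
  "degree_one R (\<lambda>b. p b \<oplus> q b) =
    degree_one R p \<oplus>\<^bsub>free_nonassoc_algebra R B\<^esub> degree_one R q"
  by (auto simp: degree_one_def fun_eq_iff split: nonassoc_word.splits)

lemma (in cring) degree_one_smult:
  "c \<in> carrier R \<Longrightarrow> degree_one R (\<lambda>b. c \<otimes> p b) =
    c \<odot>\<^bsub>free_nonassoc_algebra R B\<^esub> degree_one R p"
  by (auto simp: degree_one_def fun_eq_iff split: nonassoc_word.splits)

lemma degree_one_single: "degree_one R (single R b) = single R (Letter b)"
  by (auto simp: degree_one_def single_def fun_eq_iff split: nonassoc_word.splits)

lemma degree_one_inj: "inj (degree_one R)"
proof (rule injI)
  fix p q assume eq: "degree_one R p = degree_one R q"
  show "p = q"
  proof
    fix b show "p b = q b"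
      using fun_cong[OF eq, of "Letter b"] by (simp add: degree_one_def)
  qed
qed

text \<open>A basis vector \<open>b\<close> has the letter \<open>b\<close> as its image in degree
  one. Existence rests on both sides being linear in \<open>v\<close> and equal on basis vectors,
  uniqueness on letters determining a homomorphism.\<close>

lemma (in module_with_basis) free_nonassoc_algebra_universal:
  assumes A: "nonassoc_algebra R A" and f: "f \<in> linear_maps R M A"
  shows "\<exists>!g. g \<in> algebra_homs R (free_nonassoc_algebra R B) A \<and>
    (\<forall>v\<in>carrier M. g (degree_one R (coords R M B v)) = f v)"
proof -
  interpret A: nonassoc_algebra R A by fact
  let ?E = "free_nonassoc_algebra R B"
  have fB: "f \<in> B \<rightarrow> carrier A"
    using linear_mapsD(1)[OF f] basis_subset by auto
  note mod = R.free_module A.module_axioms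
  have f0: "f \<zero>\<^bsub>M\<^esub> = \<zero>\<^bsub>A\<^esub>"
    using linear_mapsD(3)[OF f, of \<zero> "\<zero>\<^bsub>M\<^esub>"] linear_mapsD(1)[OF f, of "\<zero>\<^bsub>M\<^esub>"] by simp
  have extends: "g (degree_one R (coords R M B v)) = f v"
    if g: "g \<in> algebra_homs R ?E A" and letter: "\<And>b. b \<in> B \<Longrightarrow> g (single R (Letter b)) = f b"
      and v: "v \<in> carrier M" for g v
  proof -
    \<comment> \<open>The induction runs over coefficient functions rather than vectors, since each
      of its cases is then a linear operation. The claim for \<open>v\<close> is the instance at its
      coordinates.\<close>
    have "g (degree_one R p) = f (lincomb R M (\<lambda>b. b) p)" if "p \<in> finsupp R B" for p
      using that
    proof (induction p rule: R.finsupp_induct)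
      case zero
      have "degree_one R (\<lambda>b. \<zero>) = \<zero>\<^bsub>?E\<^esub>"
        by (auto simp: degree_one_def fun_eq_iff split: nonassoc_word.splits)
      then show ?case using algebra_homs_zero[OF mod g] by (simp only: lincomb_zero f0)
    next
      case (single c b)
      then have b: "b \<in> carrier M" using basis_subset by auto
      note s = R.finsupp_single[OF single(2)]
      have "g (degree_one R (\<lambda>j. c \<otimes> single R b j)) = c \<odot>\<^bsub>A\<^esub> f b"
        using algebra_homsD(3)[OF g single(1) R.degree_one_closed[OF s]] letter[OF single(2)]
        by (simp only: R.degree_one_smult[OF single(1), of "single R b" B] degree_one_single)
      also have "\<dots> = f (lincomb R M (\<lambda>b. b) (\<lambda>j. c \<otimes> single R b j))"
        using linear_mapsD(3)[OF f single(1) b] lincomb_single[of "\<lambda>b. b" b] b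
        by (simp add: lincomb_smult[OF single(1) s basis_fun])
      finally show ?case .
    next
      case (add p q)
      show ?case
        using algebra_homsD(2)[OF g R.degree_one_closed R.degree_one_closed, OF add(1,2)] add(3,4)
          linear_mapsD(2)[OF f lincomb_closed lincomb_closed, OF add(1) basis_fun add(2) basis_fun]
        by (simp only: R.degree_one_add[of p q B] lincomb_add[OF add(1,2) basis_fun])
    qed
    from this[OF coords_finsupp[OF v]] show ?thesis by (simp add: lincomb_coords v)
  qed
  show ?thesis
  proof (rule ex1I)
    show "free_lift R B A f \<in> algebra_homs R ?E A \<and>
      (\<forall>v\<in>carrier M. free_lift R B A f (degree_one R (coords R M B v)) = f v)"
      using extends[OF A.free_lift_hom[OF fB] A.free_lift_letter[OF fB]] A.free_lift_hom[OF fB]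
      by blast
  next
    fix g assume g: "g \<in> algebra_homs R ?E A \<and>
      (\<forall>v\<in>carrier M. g (degree_one R (coords R M B v)) = f v)"
    show "g = free_lift R B A f"
    proof (rule free_homs_eqI[OF A _ A.free_lift_hom[OF fB]])
      fix b assume b: "b \<in> B"
      \<comment> \<open>The coordinates of \<open>b\<close> are \<open>single R b\<close>, so the
        hypothesis at the vector \<open>b\<close> speaks about a letter.\<close>
      have "g (single R (Letter b)) = f b"
        using g b basis_subset coords_basis[OF b] degree_one_single by (metis subsetD)
      then show "g (single R (Letter b)) = free_lift R B A f (single R (Letter b))"
        by (simp add: A.free_lift_letter[OF fB b])
    qed (use g in blast)
  qed
qed

text \<open>Identities and inverses pass along any surjection compatible with the operations. The
  map \<open>h\<close> will be \<open>encode\<close> for the algebra, \<open>K_incl\<close> for the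
  distinguished submodule and the identity for restricted scalars.\<close>

lemma abelian_group_image:
  assumes A: "abelian_group A" and img: "h ` carrier A = carrier C"
    and add: "\<And>x y. x \<in> carrier A \<Longrightarrow> y \<in> carrier A \<Longrightarrow> h x \<oplus>\<^bsub>C\<^esub> h y = h (x \<oplus>\<^bsub>A\<^esub> y)"
    and zero: "\<zero>\<^bsub>C\<^esub> = h \<zero>\<^bsub>A\<^esub>"
  shows "abelian_group C"
proof -
  interpret A: abelian_group A by fact
  show ?thesis
  proof (rule abelian_groupI; unfold img[symmetric] zero)
    fix z assume "z \<in> h ` carrier A"
    then obtain x where x: "x \<in> carrier A" "z = h x" by auto
    then show "\<exists>y\<in>h ` carrier A. y \<oplus>\<^bsub>C\<^esub> z = h \<zero>\<^bsub>A\<^esub>"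
      by (intro bexI[of _ "h (\<ominus>\<^bsub>A\<^esub> x)"]) (auto simp: add A.l_neg)
  qed (auto simp: add A.a_ac)
qed

lemma module_image:
  assumes A: "module F A" and img: "h ` carrier A = carrier C"
    and add: "\<And>x y. x \<in> carrier A \<Longrightarrow> y \<in> carrier A \<Longrightarrow> h x \<oplus>\<^bsub>C\<^esub> h y = h (x \<oplus>\<^bsub>A\<^esub> y)"
    and zero: "\<zero>\<^bsub>C\<^esub> = h \<zero>\<^bsub>A\<^esub>"
    and smult: "\<And>c x. c \<in> carrier F \<Longrightarrow> x \<in> carrier A \<Longrightarrow> c \<odot>\<^bsub>C\<^esub> h x = h (c \<odot>\<^bsub>A\<^esub> x)"
  shows "module F C"
proof -
  interpret A: module F A by fact
  have "abelian_group C"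
    by (rule abelian_group_image[OF A.abelian_group_axioms img add zero])
  then show ?thesis
    by (intro moduleI) (auto simp: img[symmetric] A.R.is_cring add smult A.smult_l_distr A.smult_r_distr A.smult_assoc1)
qed

lemma nonassoc_algebra_image:
  assumes A: "nonassoc_algebra F A" and img: "h ` carrier A = carrier C"
    and add: "\<And>x y. x \<in> carrier A \<Longrightarrow> y \<in> carrier A \<Longrightarrow> h x \<oplus>\<^bsub>C\<^esub> h y = h (x \<oplus>\<^bsub>A\<^esub> y)"
    and zero: "\<zero>\<^bsub>C\<^esub> = h \<zero>\<^bsub>A\<^esub>"
    and smult: "\<And>c x. c \<in> carrier F \<Longrightarrow> x \<in> carrier A \<Longrightarrow> c \<odot>\<^bsub>C\<^esub> h x = h (c \<odot>\<^bsub>A\<^esub> x)"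
    and mult: "\<And>x y. x \<in> carrier A \<Longrightarrow> y \<in> carrier A \<Longrightarrow> h x \<otimes>\<^bsub>C\<^esub> h y = h (x \<otimes>\<^bsub>A\<^esub> y)"
  shows "nonassoc_algebra F C"
proof -
  interpret A: nonassoc_algebra F A by fact
  have "module F C"
    by (rule module_image[OF A.module_axioms img add zero smult])
  then show ?thesis
    by (intro nonassoc_algebra.intro nonassoc_algebra_axioms.intro)
      (auto simp: img[symmetric] add smult mult A.mult_closed A.mult_l_distr A.mult_r_distr
        A.smult_mult_left A.smult_mult_right)
qed

lemma left_module_image:
  assumes V: "left_module H V" and img: "h ` carrier V = carrier W"
    and add: "\<And>x y. x \<in> carrier V \<Longrightarrow> y \<in> carrier V \<Longrightarrow> h x \<oplus>\<^bsub>W\<^esub> h y = h (x \<oplus>\<^bsub>V\<^esub> y)"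
    and zero: "\<zero>\<^bsub>W\<^esub> = h \<zero>\<^bsub>V\<^esub>"
    and smult: "\<And>c x. c \<in> carrier H \<Longrightarrow> x \<in> carrier V \<Longrightarrow> c \<odot>\<^bsub>W\<^esub> h x = h (c \<odot>\<^bsub>V\<^esub> x)"
  shows "left_module H W"
proof -
  interpret V: left_module H V by fact
  have "abelian_group W"
    by (rule abelian_group_image[OF V.V.abelian_group_axioms img add zero])
  then show ?thesis
    by (intro left_module.intro left_module_axioms.intro)
      (auto simp: img[symmetric] V.ring_axioms add smult V.smult_closed V.smult_l_distr V.smult_r_distr
        V.smult_assoc V.smult_one)
qed

text \<open>A coefficient function is recovered from the graph of its nonzero values. Finite support
  matters because \<open>Abs_fset\<close> is injective on finite sets.\<close>

lemma encode_inj: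
  fixes F :: "('f, 's) ring_scheme" and I :: "('f, 'x) universe nonassoc_word set"
  shows "inj_on (encode F) (finsupp F I)"
proof (rule inj_onI)
  fix p q :: "('f, 'x) universe nonassoc_word \<Rightarrow> 'f"
  assume p: "p \<in> finsupp F I" and q: "q \<in> finsupp F I" and eq: "encode F p = encode F q"
  have fin: "finite {(w, p w) | w. p w \<noteq> \<zero>\<^bsub>F\<^esub>}" if "p \<in> finsupp F I"
    for p :: "('f, 'x) universe nonassoc_word \<Rightarrow> 'f"
    using that by (simp add: finsupp_def setcompr_eq_image)
  have graph: "{(w, p w) | w. p w \<noteq> \<zero>\<^bsub>F\<^esub>} = {(w, q w) | w. q w \<noteq> \<zero>\<^bsub>F\<^esub>}"
    using eq fin[OF p] fin[OF q] by (simp add: encode_def Abs_fset_inject)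
  show "p = q"
  proof
    fix w show "p w = q w"
      using eqset_imp_iff[OF graph, of "(w, p w)"] eqset_imp_iff[OF graph, of "(w, q w)"] by auto
  qed
qed

section \<open>The vector space over F underlying an H-module\<close>

lemma restrict_scalars_simps [simp]:
  "carrier (restrict_scalars H V) = carrier V"
  "\<zero>\<^bsub>restrict_scalars H V\<^esub> = \<zero>\<^bsub>V\<^esub>"
  "x \<oplus>\<^bsub>restrict_scalars H V\<^esub> y = x \<oplus>\<^bsub>V\<^esub> y"
  "c \<odot>\<^bsub>restrict_scalars H V\<^esub> x = (c \<odot>\<^bsub>H\<^esub> \<one>\<^bsub>H\<^esub>) \<odot>\<^bsub>V\<^esub> x"
  by (simp_all add: restrict_scalars_def)

lemma restrict_scalars_module:
  assumes "unital_assoc_algebra F H" "left_module H V"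
  shows "module F (restrict_scalars H V)"
proof -
  interpret H: unital_assoc_algebra F H by fact
  interpret V: left_module H V by fact
  have "abelian_group (restrict_scalars H V)"
    by (rule abelian_group_image[OF V.V.abelian_group_axioms, of "\<lambda>x. x"]) simp_all
  \<comment> \<open>Sending a scalar to its multiple of the unit of H respects products, which turns
    associativity of the H-action into the associative law for scalars from F.\<close>
  moreover have "(a \<otimes>\<^bsub>F\<^esub> b) \<odot>\<^bsub>H\<^esub> \<one>\<^bsub>H\<^esub> = (a \<odot>\<^bsub>H\<^esub> \<one>\<^bsub>H\<^esub>) \<otimes>\<^bsub>H\<^esub> (b \<odot>\<^bsub>H\<^esub> \<one>\<^bsub>H\<^esub>)"
    if "a \<in> carrier F" "b \<in> carrier F" for a b
    using that by (simp add: H.smult_mult_left H.smult_assoc1)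
  ultimately show ?thesis
    by (intro moduleI)
      (auto simp: H.R.is_cring V.smult_closed V.smult_r_distr V.smult_l_distr H.smult_l_distr
        V.smult_assoc V.smult_one)
qed


section \<open>The categories and the forgetful functor\<close>

text \<open>Of the domain only closure under its operations is assumed, so the lemma serves algebras
  over F, modules over H and the records \<open>U_ob A\<close> alike.\<close>

lemma linear_maps_compose:
  assumes f: "f \<in> linear_maps R U V" and g: "g \<in> linear_maps R V W"
    and "\<And>x y. x \<in> carrier U \<Longrightarrow> y \<in> carrier U \<Longrightarrow> x \<oplus>\<^bsub>U\<^esub> y \<in> carrier U"
    and "\<And>r x. r \<in> carrier R \<Longrightarrow> x \<in> carrier U \<Longrightarrow> r \<odot>\<^bsub>U\<^esub> x \<in> carrier U"
  shows "compose (carrier U) g f \<in> linear_maps R U W"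
  using assms(3,4) linear_mapsD(1-3)[OF f] linear_mapsD(1-3)[OF g]
  by (auto simp: linear_maps_def compose_def)

lemma linear_maps_id:
  assumes "\<And>x y. x \<in> carrier U \<Longrightarrow> y \<in> carrier U \<Longrightarrow> x \<oplus>\<^bsub>U\<^esub> y \<in> carrier U"
    and "\<And>r x. r \<in> carrier R \<Longrightarrow> x \<in> carrier U \<Longrightarrow> r \<odot>\<^bsub>U\<^esub> x \<in> carrier U"
  shows "restrict id (carrier U) \<in> linear_maps R U U"
  using assms by (auto simp: linear_maps_def)

lemma algebra_homs_compose:
  assumes A: "nonassoc_algebra F A"
    and f: "f \<in> algebra_homs F A B" and g: "g \<in> algebra_homs F B C"
  shows "compose (carrier A) g f \<in> algebra_homs F A C"
proof -
  interpret A: nonassoc_algebra F A by fact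
  have "compose (carrier A) g f \<in> linear_maps F A C"
    using f g by (intro linear_maps_compose[where V = B]) (auto simp: algebra_homs_def)
  then show ?thesis
    using algebra_homsD(1,4)[OF f] algebra_homsD(4)[OF g]
    by (auto simp: algebra_homs_def compose_def A.mult_closed)
qed

lemma algebra_homs_id:
  assumes A: "nonassoc_algebra F A"
  shows "restrict id (carrier A) \<in> algebra_homs F A A"
proof -
  interpret A: nonassoc_algebra F A by fact
  show ?thesis
    using linear_maps_id[of A F] by (auto simp: algebra_homs_def A.mult_closed)
qed

lemma U_ob_simps [simp]:
  "carrier (U_ob A) = dsub A"
  "\<zero>\<^bsub>U_ob A\<^esub> = \<zero>\<^bsub>A\<^esub>"
  "x \<oplus>\<^bsub>U_ob A\<^esub> y = x \<oplus>\<^bsub>A\<^esub> y"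
  "h \<odot>\<^bsub>U_ob A\<^esub> x = hact A h x"
  by (simp_all add: U_ob_def)

lemma HMod_simps [simp]:
  "V \<in> Ob (HMod H) \<longleftrightarrow> left_module H V"
  "Hom (HMod H) V W = linear_maps H V W"
  "Ident (HMod H) V = restrict id (carrier V)"
  "Comp (HMod H) U V W g f = compose (carrier U) g f"
  by (simp_all add: HMod_def)

text \<open>For morphisms, the clause on the restriction also places the values of \<open>f\<close>
  on \<open>dsub A\<close> inside \<open>dsub B\<close>, the carrier of
  \<open>U_ob B\<close>.\<close>

lemma NAAlgSubMod_simps [simp]:
  "A \<in> Ob (NAAlgSubMod F H) \<longleftrightarrow> alg_with_submod F H A"
  "f \<in> Hom (NAAlgSubMod F H) A B \<longleftrightarrow> f \<in> algebra_homs F A B \<and>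
    restrict f (dsub A) \<in> linear_maps H (U_ob A) (U_ob B)"
  "Ident (NAAlgSubMod F H) A = restrict id (carrier A)"
  "Comp (NAAlgSubMod F H) A B C g f = compose (carrier A) g f"
  by (auto simp: NAAlgSubMod_def dest: linear_mapsD(1))

lemma left_module_closed:
  assumes "left_module H V"
  shows "\<And>x y. x \<in> carrier V \<Longrightarrow> y \<in> carrier V \<Longrightarrow> x \<oplus>\<^bsub>V\<^esub> y \<in> carrier V"
    and "\<And>h x. h \<in> carrier H \<Longrightarrow> x \<in> carrier V \<Longrightarrow> h \<odot>\<^bsub>V\<^esub> x \<in> carrier V"
proof -
  interpret V: left_module H V by fact
  show "\<And>x y. x \<in> carrier V \<Longrightarrow> y \<in> carrier V \<Longrightarrow> x \<oplus>\<^bsub>V\<^esub> y \<in> carrier V" by simp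
  show "\<And>h x. h \<in> carrier H \<Longrightarrow> x \<in> carrier V \<Longrightarrow> h \<odot>\<^bsub>V\<^esub> x \<in> carrier V"
    by (rule V.smult_closed)
qed

lemma compose_id_right: "f \<in> extensional A \<Longrightarrow> compose A f (restrict id A) = f"
  by (rule extensionalityI[of _ A]) (auto simp: compose_def)

lemma compose_id_left:
  "f \<in> extensional A \<Longrightarrow> (\<And>x. x \<in> A \<Longrightarrow> f x \<in> B) \<Longrightarrow> compose A (restrict id B) f = f"
  by (rule extensionalityI[of _ A]) (auto simp: compose_def)

lemma compose_compose:
  "(\<And>x. x \<in> A \<Longrightarrow> f x \<in> B) \<Longrightarrow> compose A (compose B h g) f = compose A h (compose A g f)"
  by (rule extensionalityI[of _ A]) (auto simp: compose_def)

lemma HMod_category: "is_category (HMod H)"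
proof (unfold_locales; unfold HMod_simps)
qed (auto intro!: linear_maps_id linear_maps_compose left_module_closed
    compose_id_right compose_id_left compose_compose intro: linear_mapsD)

lemma alg_with_submodD:
  assumes "alg_with_submod F H A"
  shows "nonassoc_algebra F A" "left_module H (U_ob A)" "dsub A \<subseteq> carrier A"
    "\<And>c x. c \<in> carrier F \<Longrightarrow> x \<in> dsub A \<Longrightarrow> hact A (c \<odot>\<^bsub>H\<^esub> \<one>\<^bsub>H\<^esub>) x = c \<odot>\<^bsub>A\<^esub> x"
proof -
  interpret A: alg_with_submod F H A by fact
  show "nonassoc_algebra F A" ..
  show "left_module H (U_ob A)" by (rule A.dsub_left_module)
  show "dsub A \<subseteq> carrier A" using A.subset by simp
  show "\<And>c x. c \<in> carrier F \<Longrightarrow> x \<in> dsub A \<Longrightarrow> hact A (c \<odot>\<^bsub>H\<^esub> \<one>\<^bsub>H\<^esub>) x = c \<odot>\<^bsub>A\<^esub> x"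
    by (rule A.hact_scalar)
qed

text \<open>Since \<open>f\<close> maps \<open>dsub A\<close> into \<open>dsub B\<close>, cutting
  \<open>g\<close> down to \<open>dsub B\<close> changes nothing. This serves both closure of
  morphisms under composition and functoriality of U.\<close>

lemma restrict_compose_dsub:
  assumes "dsub A \<subseteq> carrier A" "restrict f (dsub A) \<in> linear_maps H (U_ob A) (U_ob B)"
  shows "restrict (compose (carrier A) g f) (dsub A) =
    compose (dsub A) (restrict g (dsub B)) (restrict f (dsub A))"
proof (rule extensionalityI[of _ "dsub A"])
  fix x assume x: "x \<in> dsub A"
  then show "restrict (compose (carrier A) g f) (dsub A) x =
      compose (dsub A) (restrict g (dsub B)) (restrict f (dsub A)) x"
    using assms(1) linear_mapsD(1)[OF assms(2), of x] by (auto simp: compose_def)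
qed auto

lemma NAAlgSubMod_category: "is_category (NAAlgSubMod F H)"
proof (unfold_locales; unfold NAAlgSubMod_simps)
  fix A assume A: "alg_with_submod F H A"
  note D = alg_with_submodD[OF A]
  have "restrict id (carrier (U_ob A)) \<in> linear_maps H (U_ob A) (U_ob A)"
    by (intro linear_maps_id left_module_closed[OF D(2)])
  then show "restrict id (carrier A) \<in> algebra_homs F A A \<and>
      restrict (restrict id (carrier A)) (dsub A) \<in> linear_maps H (U_ob A) (U_ob A)"
    using algebra_homs_id[OF D(1)] by (simp add: Int_absorb1[OF D(3)])
next
  fix A B C f g
  assume A: "alg_with_submod F H A"
    and f: "f \<in> algebra_homs F A B \<and> restrict f (dsub A) \<in> linear_maps H (U_ob A) (U_ob B)"
    and g: "g \<in> algebra_homs F B C \<and> restrict g (dsub B) \<in> linear_maps H (U_ob B) (U_ob C)"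
  note D = alg_with_submodD[OF A]
  have "compose (carrier (U_ob A)) (restrict g (dsub B)) (restrict f (dsub A))
      \<in> linear_maps H (U_ob A) (U_ob C)"
    using f g by (intro linear_maps_compose[where V = "U_ob B"] left_module_closed[OF D(2)]) auto
  then have "restrict (compose (carrier A) g f) (dsub A) \<in> linear_maps H (U_ob A) (U_ob C)"
    using restrict_compose_dsub[OF D(3) conjunct2[OF f], of g] by (simp only: U_ob_simps)
  then show "compose (carrier A) g f \<in> algebra_homs F A C \<and>
      restrict (compose (carrier A) g f) (dsub A) \<in> linear_maps H (U_ob A) (U_ob C)"
    using f g algebra_homs_compose[OF D(1)] by blast
qed (auto intro!: compose_id_right compose_id_left compose_compose intro: algebra_homsD)

lemma U_functor: "is_functor (NAAlgSubMod F H) (HMod H) U_ob U_arr"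
proof (intro is_functor.intro HMod_category NAAlgSubMod_category is_functor_axioms.intro;
    unfold NAAlgSubMod_simps HMod_simps U_arr_def)
qed (auto simp: alg_with_submodD Int_absorb1 restrict_compose_dsub)


section \<open>The algebra on a module\<close>

text \<open>One module is fixed; for an arrow or a composite the locale is interpreted at several
  modules side by side. The field assumption supplies the basis.\<close>

locale free_on_module =
  fixes F :: "('f, 's) ring_scheme" and H :: "('f, 'h, 'n) module_scheme"
    and V :: "('h, ('f, 'x) universe) module"
  assumes field: "field F" and algebra: "unital_assoc_algebra F H"
    and left_module: "left_module H V"
begin

abbreviation E :: "('f, ('f, 'x) universe nonassoc_word \<Rightarrow> 'f) module"
  where "E \<equiv> free_nonassoc_algebra F (chosen_basis F H V)"

abbreviation K :: "('f, 'h, ('f, 'x) universe) alg_submod"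
  where "K \<equiv> K_ob F H V"

abbreviation incl :: "('f, 'x) universe \<Rightarrow> ('f, 'x) universe"
  where "incl \<equiv> K_incl F H V"

abbreviation degone :: "('f, 'x) universe \<Rightarrow> ('f, 'x) universe nonassoc_word \<Rightarrow> 'f"
  where "degone v \<equiv> degree_one F (coords F (restrict_scalars H V) (chosen_basis F H V) v)"

sublocale VF: module_with_basis F "restrict_scalars H V" "chosen_basis F H V"
proof (intro module_with_basis.intro module_with_basis_axioms.intro)
  show mod: "module F (restrict_scalars H V)"
    by (rule restrict_scalars_module[OF algebra left_module])
  show "is_basis F (restrict_scalars H V) (chosen_basis F H V)"
    unfolding chosen_basis_def by (rule someI_ex) (rule module.exists_basis[OF mod field])
qed

sublocale E: nonassoc_algebra F E
  by (rule VF.R.free_nonassoc_algebra)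

lemma encode_inj_E: "inj_on (encode F) (carrier E)"
  by (simp add: encode_inj)

text \<open>Injectivity of \<open>encode\<close> cancels the decoding map inside
  \<open>transport\<close>, so later computations in K V can be carried out on coefficient
  functions.\<close>

lemma K_encode:
  "carrier K = encode F ` carrier E"
  "\<zero>\<^bsub>K\<^esub> = encode F \<zero>\<^bsub>E\<^esub>"
  "p \<in> carrier E \<Longrightarrow> q \<in> carrier E \<Longrightarrow> encode F p \<oplus>\<^bsub>K\<^esub> encode F q = encode F (p \<oplus>\<^bsub>E\<^esub> q)"
  "p \<in> carrier E \<Longrightarrow> q \<in> carrier E \<Longrightarrow> encode F p \<otimes>\<^bsub>K\<^esub> encode F q = encode F (p \<otimes>\<^bsub>E\<^esub> q)"
  "p \<in> carrier E \<Longrightarrow> c \<odot>\<^bsub>K\<^esub> encode F p = encode F (c \<odot>\<^bsub>E\<^esub> p)"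
  by (simp_all add: K_ob_def transport_def module.defs alg_submod.defs Let_def
      inv_into_f_f[OF encode_inj_E] del: free_nonassoc_algebra_simps)

lemma dsub_K: "dsub K = incl ` carrier V"
  by (simp add: K_ob_def module.defs alg_submod.defs)

lemma degone_closed: "v \<in> carrier V \<Longrightarrow> degone v \<in> carrier E"
  by (intro VF.R.degree_one_closed VF.coords_finsupp) simp

lemma incl_encode: "incl v = encode F (degone v)"
  by (simp add: K_incl_def)

lemma incl_closed: "v \<in> carrier V \<Longrightarrow> incl v \<in> carrier K"
  unfolding K_encode(1) incl_encode by (intro imageI degone_closed)

text \<open>A composite of three injections: coordinates, placement on letters, encoding. It is
  needed because the action \<open>hact\<close> on K V reads \<open>v\<close> back from its
  image.\<close>

lemma incl_inj: "inj_on incl (carrier V)"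
proof (rule inj_onI)
  fix v w assume vw: "v \<in> carrier V" "w \<in> carrier V" "incl v = incl w"
  then have "degone v = degone w"
    unfolding incl_encode by (intro inj_onD[OF encode_inj_E] degone_closed)
  then show "v = w"
    using vw by (auto dest!: injD[OF degree_one_inj] intro: inj_onD[OF VF.coords_inj])
qed

lemma incl_add:
  assumes "v \<in> carrier V" "w \<in> carrier V"
  shows "incl v \<oplus>\<^bsub>K\<^esub> incl w = incl (v \<oplus>\<^bsub>V\<^esub> w)"
proof -
  have "degone (v \<oplus>\<^bsub>V\<^esub> w) = degone v \<oplus>\<^bsub>E\<^esub> degone w"
    using VF.coords_add[of v w] assms
    by (simp add: VF.R.degree_one_add[of _ _ "chosen_basis F H V"] del: free_nonassoc_algebra_simps)
  then show ?thesis
    unfolding incl_encode K_encode(3)[OF assms[THEN degone_closed]] by simp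
qed

lemma incl_smult:
  assumes "c \<in> carrier F" "v \<in> carrier V"
  shows "c \<odot>\<^bsub>K\<^esub> incl v = incl ((c \<odot>\<^bsub>H\<^esub> \<one>\<^bsub>H\<^esub>) \<odot>\<^bsub>V\<^esub> v)"
proof -
  have "degone ((c \<odot>\<^bsub>H\<^esub> \<one>\<^bsub>H\<^esub>) \<odot>\<^bsub>V\<^esub> v) = c \<odot>\<^bsub>E\<^esub> degone v"
    using VF.coords_smult[of c v] assms
    by (simp add: VF.R.degree_one_smult[of _ _ "chosen_basis F H V"] del: free_nonassoc_algebra_simps)
  then show ?thesis
    unfolding incl_encode K_encode(5)[OF degone_closed[OF assms(2)]] by simp
qed

lemma incl_zero: "\<zero>\<^bsub>K\<^esub> = incl \<zero>\<^bsub>V\<^esub>"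
proof -
  have "coords F (restrict_scalars H V) (chosen_basis F H V) \<zero>\<^bsub>V\<^esub> = (\<lambda>b. \<zero>\<^bsub>F\<^esub>)"
    using VF.coords_lincomb[OF VF.R.finsupp_zero] by (simp add: VF.lincomb_zero)
  then show ?thesis
    by (simp add: incl_encode K_encode(2))
      (auto simp: degree_one_def fun_eq_iff intro!: arg_cong[of _ _ "encode F"] split: nonassoc_word.split)
qed

lemma hact_K:
  "v \<in> carrier V \<Longrightarrow> hact K h (incl v) = incl (h \<odot>\<^bsub>V\<^esub> v)"
  by (simp add: K_ob_def module.defs alg_submod.defs inv_into_f_f[OF incl_inj])

lemma K_nonassoc_algebra: "nonassoc_algebra F K"
  by (rule nonassoc_algebra_image[OF E.nonassoc_algebra_axioms, of "encode F"])
    (simp_all add: K_encode del: free_nonassoc_algebra_simps)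

lemma U_K_left_module: "left_module H (U_ob K)"
  by (rule left_module_image[OF left_module, of incl])
    (simp_all add: dsub_K incl_add incl_zero hact_K)

lemma K_alg_with_submod: "alg_with_submod F H K"
proof (intro alg_with_submod.intro alg_with_submod_axioms.intro K_nonassoc_algebra U_K_left_module)
  interpret K: nonassoc_algebra F K by (rule K_nonassoc_algebra)
  note cl = left_module_closed[OF left_module]
  interpret H: unital_assoc_algebra F H by (rule algebra)
  \<comment> \<open>A scalar of F acts on the image of V through its multiple of the unit of H, so
    closure under H gives closure under F. Negatives follow from the scalar -1.\<close>
  have smult: "c \<odot>\<^bsub>K\<^esub> x \<in> dsub K" if "c \<in> carrier F" "x \<in> dsub K" for c x
    using that by (auto simp: dsub_K incl_smult intro!: imageI cl)
  show "submodule (dsub K) F K"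
  proof (rule K.submoduleI)
    show sub: "dsub K \<subseteq> carrier K" by (auto simp: dsub_K incl_closed)
    show "\<zero>\<^bsub>K\<^esub> \<in> dsub K"
      using VF.M.zero_closed by (simp add: dsub_K incl_zero)
    show "\<ominus>\<^bsub>K\<^esub> x \<in> dsub K" if "x \<in> dsub K" for x
      using smult[of "\<ominus>\<^bsub>F\<^esub> \<one>\<^bsub>F\<^esub>" x] that sub K.smult_l_minus[of "\<one>\<^bsub>F\<^esub>" x] by auto
    show "x \<oplus>\<^bsub>K\<^esub> y \<in> dsub K" if "x \<in> dsub K" "y \<in> dsub K" for x y
      using that by (auto simp: dsub_K incl_add intro!: imageI cl)
  qed (rule smult)
  show "hact K (c \<odot>\<^bsub>H\<^esub> \<one>\<^bsub>H\<^esub>) x = c \<odot>\<^bsub>K\<^esub> x" if "c \<in> carrier F" "x \<in> dsub K" for c x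
    using that by (auto simp: dsub_K incl_smult hact_K)
qed

text \<open>The map \<open>encode\<close> is an isomorphism of \<open>E\<close> onto
  \<open>K\<close>. Existence composes the extension on \<open>E\<close> with decoding; uniqueness
  pulls a candidate back along \<open>encode\<close>.\<close>

lemma K_universal:
  assumes A: "nonassoc_algebra F A" and f: "f \<in> linear_maps F (restrict_scalars H V) A"
  shows "\<exists>!g. g \<in> algebra_homs F K A \<and> (\<forall>v\<in>carrier V. g (incl v) = f v)"
proof -
  let ?P = "\<lambda>g. g \<in> algebra_homs F E A \<and> (\<forall>v\<in>carrier V. g (degone v) = f v)"
  let ?Q = "\<lambda>g. g \<in> algebra_homs F K A \<and> (\<forall>v\<in>carrier V. g (incl v) = f v)"
  let ?d = "inv_into (carrier E) (encode F)"
  have encode: "restrict (encode F) (carrier E) \<in> algebra_homs F E K"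
    by (auto simp: algebra_homs_def linear_maps_def K_encode E.mult_closed
        simp del: free_nonassoc_algebra_simps)
  have unique: "\<exists>!g. ?P g"
    using VF.free_nonassoc_algebra_universal[OF A f] by simp
  then obtain g where g: "?P g" by blast
  let ?g = "\<lambda>x\<in>carrier K. g (?d x)"
  have g_encode: "?g (encode F p) = g p" if "p \<in> carrier E" for p
    using that by (simp add: K_encode(1) inv_into_f_f[OF encode_inj_E] del: free_nonassoc_algebra_simps)
  have "?g \<in> algebra_homs F K A"
  proof -
    note D = algebra_homsD[OF conjunct1[OF g]]
    have "?g \<in> carrier K \<rightarrow>\<^sub>E carrier A"
      using D(1) by (auto simp: K_encode(1) inv_into_f_f[OF encode_inj_E] simp del: free_nonassoc_algebra_simps)
    moreover have "?g (x \<oplus>\<^bsub>K\<^esub> y) = ?g x \<oplus>\<^bsub>A\<^esub> ?g y" "?g (x \<otimes>\<^bsub>K\<^esub> y) = ?g x \<otimes>\<^bsub>A\<^esub> ?g y"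
      if x: "x \<in> carrier K" and y: "y \<in> carrier K" for x y
    proof -
      obtain p q where pq: "p \<in> carrier E" "q \<in> carrier E" and xy: "x = encode F p" "y = encode F q"
        using x y unfolding K_encode(1) by blast
      show "?g (x \<oplus>\<^bsub>K\<^esub> y) = ?g x \<oplus>\<^bsub>A\<^esub> ?g y"
        unfolding xy K_encode(3)[OF pq] g_encode[OF pq(1)] g_encode[OF pq(2)]
          g_encode[OF E.a_closed[OF pq]] by (rule D(2)[OF pq])
      show "?g (x \<otimes>\<^bsub>K\<^esub> y) = ?g x \<otimes>\<^bsub>A\<^esub> ?g y"
        unfolding xy K_encode(4)[OF pq] g_encode[OF pq(1)] g_encode[OF pq(2)]
          g_encode[OF E.mult_closed[OF pq]] by (rule D(4)[OF pq])
    qed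
    moreover have "?g (c \<odot>\<^bsub>K\<^esub> x) = c \<odot>\<^bsub>A\<^esub> ?g x" if c: "c \<in> carrier F" and x: "x \<in> carrier K" for c x
    proof -
      obtain p where p: "p \<in> carrier E" and xp: "x = encode F p"
        using x unfolding K_encode(1) by blast
      show ?thesis
        unfolding xp K_encode(5)[OF p] g_encode[OF p] g_encode[OF E.smult_closed[OF c p]]
        by (rule D(3)[OF c p])
    qed
    ultimately show ?thesis by (simp only: algebra_homs_def linear_maps_def mem_Collect_eq) blast
  qed
  moreover have "?g (incl v) = f v" if "v \<in> carrier V" for v
    using g_encode[OF degone_closed[OF that]] g that by (simp add: incl_encode)
  ultimately have Q: "?Q ?g" by blast
  have "h = ?g" if h: "?Q h" for h
  proof -
    \<comment> \<open>The pulled-back homomorphism extends \<open>f\<close> on degree one, so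
      uniqueness on \<open>E\<close> identifies it with \<open>g\<close>.\<close>
    have "compose (carrier E) h (restrict (encode F) (carrier E)) \<in> algebra_homs F E A"
      using algebra_homs_compose[OF E.nonassoc_algebra_axioms encode] h by blast
    moreover have "compose (carrier E) h (restrict (encode F) (carrier E)) (degone v) = f v"
      if "v \<in> carrier V" for v
      using h that degone_closed[OF that] by (simp add: compose_def incl_encode[symmetric]
          del: free_nonassoc_algebra_simps)
    ultimately have "compose (carrier E) h (restrict (encode F) (carrier E)) = g"
      using unique g by blast
    then have "h (encode F p) = g p" if "p \<in> carrier E" for p
      using that by (auto simp: compose_def fun_eq_iff simp del: free_nonassoc_algebra_simps split: if_splits)
    then have "h x = ?g x" if "x \<in> carrier K" for x
      using that g_encode unfolding K_encode(1) by force
    then show ?thesis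
      using algebra_homsD(5)[OF conjunct1[OF h]] by (intro extensionalityI[of _ "carrier K"]) auto
  qed
  then show ?thesis using Q by (intro ex1I[of _ ?g])
qed

end


section \<open>The adjunction\<close>

text \<open>A scalar of F acts on V and on \<open>dsub A\<close> through its multiple of the unit of
  H, and by compatibility this agrees on \<open>dsub A\<close> with the scalar multiplication of A.
  It makes \<open>K_universal\<close> applicable to H-linear maps.\<close>

lemma linear_maps_restrict_scalars:
  assumes H: "unital_assoc_algebra F H" and A: "alg_with_submod F H A"
    and f: "f \<in> linear_maps H V (U_ob A)"
  shows "f \<in> linear_maps F (restrict_scalars H V) A"
proof -
  interpret H: unital_assoc_algebra F H by (rule H)
  note D = linear_mapsD[OF f]
  have "f (c \<odot>\<^bsub>restrict_scalars H V\<^esub> x) = c \<odot>\<^bsub>A\<^esub> f x"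
    if "c \<in> carrier F" "x \<in> carrier V" for c x
    using that D(1)[of x] D(3)[of "c \<odot>\<^bsub>H\<^esub> \<one>\<^bsub>H\<^esub>" x] by (simp add: alg_with_submodD(4)[OF A])
  then show ?thesis
    using D alg_with_submodD(3)[OF A] by (auto simp: linear_maps_def PiE_def)
qed

section \<open>Restriction along the inclusion of V\<close>

context free_on_module
begin

lemma incl_hom: "restrict incl (carrier V) \<in> linear_maps H V (U_ob K)"
  using left_module_closed[OF left_module]
  by (auto simp: linear_maps_def dsub_K incl_add hact_K)

text \<open>Both maps extend the F-linear map sending \<open>v\<close> to \<open>g (incl v)\<close>.
  The lemma is the tool for the functor laws and for injectivity of restriction.\<close>

lemma K_hom_eqI:
  assumes A: "nonassoc_algebra F A"
    and g: "g \<in> algebra_homs F K A" and h: "h \<in> algebra_homs F K A"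
    and eq: "\<And>v. v \<in> carrier V \<Longrightarrow> g (incl v) = h (incl v)"
  shows "g = h"
proof -
  let ?f = "\<lambda>v\<in>carrier V. g (incl v)"
  have "?f \<in> linear_maps F (restrict_scalars H V) A"
    using algebra_homsD(1)[OF g incl_closed]
      algebra_homsD(2)[OF g incl_closed incl_closed] algebra_homsD(3)[OF g _ incl_closed]
      VF.M.a_closed VF.smult_closed
    by (auto simp: linear_maps_def incl_add incl_smult)
  then have "\<exists>!g. g \<in> algebra_homs F K A \<and> (\<forall>v\<in>carrier V. g (incl v) = ?f v)"
    by (rule K_universal[OF A])
  moreover have "\<forall>v\<in>carrier V. g (incl v) = ?f v" "\<forall>v\<in>carrier V. h (incl v) = ?f v"
    using eq by simp_all
  ultimately show ?thesis using g h by blast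
qed

text \<open>The submodule of K V is the image of V with the action carried over by
  \<open>incl\<close>, so substituting \<open>incl v\<close> exchanges the two linearity conditions
  over H.\<close>

lemma K_hom_iff:
  "g \<in> Hom (NAAlgSubMod F H) K A \<longleftrightarrow> g \<in> algebra_homs F K A \<and>
    (\<lambda>v\<in>carrier V. g (incl v)) \<in> linear_maps H V (U_ob A)"
  using left_module_closed[OF left_module]
  by (auto simp: linear_maps_def dsub_K incl_add hact_K PiE_iff)

lemma transpose_bij:
  assumes A: "alg_with_submod F H A"
  shows "bij_betw (\<lambda>g. \<lambda>v\<in>carrier V. g (incl v)) (Hom (NAAlgSubMod F H) K A)
    (linear_maps H V (U_ob A))"
proof (rule bij_betw_imageI)
  note A' = alg_with_submodD(1)[OF A]
  show "inj_on (\<lambda>g. \<lambda>v\<in>carrier V. g (incl v)) (Hom (NAAlgSubMod F H) K A)"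
  proof (rule inj_onI)
    fix g h assume gh: "g \<in> Hom (NAAlgSubMod F H) K A" "h \<in> Hom (NAAlgSubMod F H) K A"
      and eq: "(\<lambda>v\<in>carrier V. g (incl v)) = (\<lambda>v\<in>carrier V. h (incl v))"
    have "g (incl v) = h (incl v)" if "v \<in> carrier V" for v
      using fun_cong[OF eq, of v] that by simp
    then show "g = h"
      using gh by (intro K_hom_eqI[OF A']) auto
  qed
  have "f \<in> (\<lambda>g. \<lambda>v\<in>carrier V. g (incl v)) ` Hom (NAAlgSubMod F H) K A"
    if f: "f \<in> linear_maps H V (U_ob A)" for f
  proof -
    obtain g where g: "g \<in> algebra_homs F K A" "\<forall>v\<in>carrier V. g (incl v) = f v"
      using K_universal[OF A' linear_maps_restrict_scalars[OF algebra A f]] by blast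
    have eq: "f = (\<lambda>v\<in>carrier V. g (incl v))"
      using g linear_mapsD(4)[OF f] by (intro extensionalityI[of _ "carrier V"]) auto
    \<comment> \<open>The extension was obtained from F-linearity alone. It respects the H-action
      because its restriction along \<open>incl\<close> is \<open>f\<close> itself.\<close>
    have "g \<in> Hom (NAAlgSubMod F H) K A"
      unfolding K_hom_iff eq[symmetric] using g f by blast
    then show ?thesis using eq by blast
  qed
  then show "(\<lambda>g. \<lambda>v\<in>carrier V. g (incl v)) ` Hom (NAAlgSubMod F H) K A =
      linear_maps H V (U_ob A)"
    unfolding K_hom_iff set_eq_iff image_iff Bex_def by blast
qed

end

section \<open>Functoriality of K and naturality of restriction\<close>

lemma K_arr:
  assumes V: "free_on_module F H V" and W: "free_on_module F H W"
    and f: "f \<in> linear_maps H V W"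
  shows K_arr_hom: "K_arr F H V W f \<in> Hom (NAAlgSubMod F H) (K_ob F H V) (K_ob F H W)"
    and K_arr_incl: "\<And>v. v \<in> carrier V \<Longrightarrow> K_arr F H V W f (K_incl F H V v) = K_incl F H W (f v)"
proof -
  interpret V: free_on_module F H V by (rule V)
  interpret W: free_on_module F H W by (rule W)
  \<comment> \<open>This is \<open>f\<close> followed by the inclusion of W, seen as an H-linear map
    into the submodule of K W; K f is its extension.\<close>
  let ?f = "compose (carrier V) (restrict W.incl (carrier W)) f"
  have f': "?f \<in> linear_maps H V (U_ob W.K)"
    by (rule linear_maps_compose[OF f W.incl_hom left_module_closed[OF V.left_module]])
  have f_eq: "?f v = W.incl (f v)" if "v \<in> carrier V" for v
    using that linear_mapsD(1)[OF f that] by (simp add: compose_def)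
  have "\<exists>!g. g \<in> algebra_homs F V.K W.K \<and> (\<forall>v\<in>carrier V. g (V.incl v) = ?f v)"
    by (rule V.K_universal[OF W.K_nonassoc_algebra
        linear_maps_restrict_scalars[OF V.algebra W.K_alg_with_submod f']])
  then have "\<exists>!g. g \<in> algebra_homs F V.K W.K \<and> (\<forall>v\<in>carrier V. g (V.incl v) = W.incl (f v))"
    by (simp add: f_eq cong: ball_cong)
  \<comment> \<open>Unique existence gives the definite description in \<open>K_arr\<close> its
    meaning; all that follows uses its two defining properties.\<close>
  from theI'[OF this, folded K_arr_def]
  have K: "K_arr F H V W f \<in> algebra_homs F V.K W.K"
    "\<And>v. v \<in> carrier V \<Longrightarrow> K_arr F H V W f (V.incl v) = W.incl (f v)"
    by blast+
  show "\<And>v. v \<in> carrier V \<Longrightarrow> K_arr F H V W f (V.incl v) = W.incl (f v)" by (rule K(2))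
  have "(\<lambda>v\<in>carrier V. K_arr F H V W f (V.incl v)) = ?f"
    by (rule extensionalityI[of _ "carrier V"]) (auto simp: K(2) f_eq)
  then show "K_arr F H V W f \<in> Hom (NAAlgSubMod F H) V.K W.K"
    unfolding V.K_hom_iff using K(1) f' by simp
qed

lemma K_functor:
  fixes F :: "('f, 's) ring_scheme" and H :: "('f, 'h, 'n) module_scheme"
  assumes F: "field F" and H: "unital_assoc_algebra F H"
  shows "is_functor
    (HMod H :: (('h, ('f, 'x) universe) module, ('f, 'x) universe \<Rightarrow> ('f, 'x) universe) category)
    (NAAlgSubMod F H) (K_ob F H) (K_arr F H)"
proof (intro is_functor.intro HMod_category NAAlgSubMod_category is_functor_axioms.intro;
    unfold HMod_simps(1,2))
  note free = free_on_module.intro[OF F H]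
  fix V :: "('h, ('f, 'x) universe) module" assume "left_module H V"
  then interpret V: free_on_module F H V by (rule free)
  show "K_ob F H V \<in> Ob (NAAlgSubMod F H)"
    by (simp add: V.K_alg_with_submod)
  have id: "restrict id (carrier V) \<in> linear_maps H V V"
    by (intro linear_maps_id left_module_closed[OF V.left_module])
  note K_id = K_arr[OF V.free_on_module_axioms V.free_on_module_axioms id]
  have "K_arr F H V V (restrict id (carrier V)) = restrict id (carrier V.K)"
    using K_id V.incl_closed
    by (intro V.K_hom_eqI[OF V.K_nonassoc_algebra] algebra_homs_id V.K_nonassoc_algebra) auto
  then show "K_arr F H V V (Ident (HMod H) V) = Ident (NAAlgSubMod F H) (K_ob F H V)"
    by simp
next
  note free = free_on_module.intro[OF F H]
  fix V W :: "('h, ('f, 'x) universe) module" and f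
  assume "left_module H V" "left_module H W" "f \<in> linear_maps H V W"
  then show "K_arr F H V W f \<in> Hom (NAAlgSubMod F H) (K_ob F H V) (K_ob F H W)"
    by (intro K_arr_hom free)
next
  note free = free_on_module.intro[OF F H]
  fix U V W :: "('h, ('f, 'x) universe) module" and f g
  assume "left_module H U" "left_module H V" "left_module H W"
    and f: "f \<in> linear_maps H U V" and g: "g \<in> linear_maps H V W"
  then interpret U: free_on_module F H U + V: free_on_module F H V + W: free_on_module F H W
    by (auto intro: free)
  note ax = U.free_on_module_axioms V.free_on_module_axioms W.free_on_module_axioms
  have gf: "compose (carrier U) g f \<in> linear_maps H U W"
    by (rule linear_maps_compose[OF f g left_module_closed[OF U.left_module]])
  note Kf = K_arr[OF ax(1,2) f] and Kg = K_arr[OF ax(2,3) g] and Kgf = K_arr[OF ax(1,3) gf]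
  have "K_arr F H U W (compose (carrier U) g f) =
      compose (carrier U.K) (K_arr F H V W g) (K_arr F H U V f)"
  proof (rule U.K_hom_eqI[OF W.K_nonassoc_algebra])
    show "K_arr F H U W (compose (carrier U) g f) \<in> algebra_homs F U.K W.K"
      using Kgf(1) by simp
    show "compose (carrier U.K) (K_arr F H V W g) (K_arr F H U V f) \<in> algebra_homs F U.K W.K"
      using Kf(1) Kg(1) by (intro algebra_homs_compose[OF U.K_nonassoc_algebra]) auto
    fix v assume v: "v \<in> carrier U"
    then show "K_arr F H U W (compose (carrier U) g f) (U.incl v) =
        compose (carrier U.K) (K_arr F H V W g) (K_arr F H U V f) (U.incl v)"
      using linear_mapsD(1)[OF f v] Kf(2) Kg(2) Kgf(2) U.incl_closed by (simp add: compose_def)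
  qed
  then show "K_arr F H U W (Comp (HMod H) U V W g f) =
      Comp (NAAlgSubMod F H) (K_ob F H U) (K_ob F H V) (K_ob F H W)
        (K_arr F H V W g) (K_arr F H U V f)"
    by simp
qed

theorem proposition7p2:
  fixes F :: "('f, 's) ring_scheme" and H :: "('f, 'h, 'n) module_scheme"
  assumes "field F" and "unital_assoc_algebra F H"
  shows "left_adjoint
    (HMod H :: (('h, ('f, 'x) universe) module, ('f, 'x) universe \<Rightarrow> ('f, 'x) universe) category)
    (NAAlgSubMod F H :: (('f, 'h, ('f, 'x) universe) alg_submod,
       ('f, 'x) universe \<Rightarrow> ('f, 'x) universe) category)
    (K_ob F H) (K_arr F H) U_ob U_arr"
  unfolding left_adjoint_def
proof (intro conjI K_functor[OF assms] U_functor
    exI[of _ "\<lambda>V A g. \<lambda>v\<in>carrier V. g (K_incl F H V v)"] ballI)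
  note free = free_on_module.intro[OF assms]
  fix V :: "('h, ('f, 'x) universe) module" and A :: "('f, 'h, ('f, 'x) universe) alg_submod"
  assume "V \<in> Ob (HMod H)" and A: "A \<in> Ob (NAAlgSubMod F H)"
  then interpret V: free_on_module F H V by (intro free) simp
  show "bij_betw (\<lambda>g. \<lambda>v\<in>carrier V. g (K_incl F H V v))
      (Hom (NAAlgSubMod F H) (K_ob F H V) A) (Hom (HMod H) V (U_ob A))"
    using V.transpose_bij[of A] A by simp
next
  note free = free_on_module.intro[OF assms]
  fix V V' :: "('h, ('f, 'x) universe) module" and A A' :: "('f, 'h, ('f, 'x) universe) alg_submod"
    and f g h
  assume "V \<in> Ob (HMod H)" "V' \<in> Ob (HMod H)"
    and f: "f \<in> Hom (HMod H) V' V" and h: "h \<in> Hom (NAAlgSubMod F H) (K_ob F H V) A"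
  then interpret V: free_on_module F H V + V': free_on_module F H V'
    by (auto intro: free)
  have f': "f \<in> linear_maps H V' V" using f by simp
  note Kf = K_arr_incl[OF V'.free_on_module_axioms V.free_on_module_axioms f']
  \<comment> \<open>\<open>U_arr\<close> cuts \<open>g\<close> down to \<open>dsub A\<close>, so the
    image of V under \<open>h\<close> has to be seen to lie there.\<close>
  have h_dsub: "h (V.incl w) \<in> dsub A" if "w \<in> carrier V" for w
    using h that linear_mapsD(1)[of _ H V "U_ob A" w] unfolding V.K_hom_iff by fastforce
  \<comment> \<open>Since K f extends \<open>f\<close>, both sides send \<open>v\<close> to
    \<open>g (h (V.incl (f v)))\<close>.\<close>
  show "(\<lambda>v\<in>carrier V'. Comp (NAAlgSubMod F H) (K_ob F H V') A A' g
          (Comp (NAAlgSubMod F H) (K_ob F H V') (K_ob F H V) A h (K_arr F H V' V f)) (K_incl F H V' v)) =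
      Comp (HMod H) V' (U_ob A) (U_ob A') (U_arr A A' g)
        (Comp (HMod H) V' V (U_ob A) (\<lambda>v\<in>carrier V. h (K_incl F H V v)) f)"
    by (rule extensionalityI[of _ "carrier V'"])
      (use linear_mapsD(1)[OF f'] V'.incl_closed h_dsub Kf in \<open>auto simp: compose_def U_arr_def\<close>)
qed

end
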